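(* Consider the Distributed Block Proximal Method described in the context, with arbitrary positive stepsizes $\alpha_i^t$. Assume there are $G_i,\bar G_i\in[0,\infty)$ with $\mathbb{E}[\|g_i(x;\xi_i)\|]\le G_i$ and $\mathbb{E}[\|g_i(x;\xi_i)\|^2]\le\bar G_i$ for all $x$ and $i$, and constants $C_i\in[0,\infty)$ with $\mathbb{E}[\|x_i^0\|]\le C_i$ for all $i$. Let $G=\sum_{i=1}^NG_i$ and $C=\sum_{i=1}^NC_i$. Then there exist constants $M\in(0,\infty)$ and $\mu_M\in(0,1)$ such that $$\mathbb{E}[\|x_i^t-\bar x^t\|]\le MB\Big((\mu_M)^{t-1}C+\frac{G}{\sigma}\sum_{s=0}^{t-2}(\mu_M)^{t-s-2}a_M^s+\frac{G}{\sigma}a_M^{t-1}\Big)$$ for all $i\in\{1,\dots,N\}$ and all $t\ge1$ (an empty sum being zero).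
   Context: Problem: minimize $\sum_{i=1}^Nf_i(x)$ over $x\in X\subseteq\mathbb{R}^n$, where $f_i(x)=\mathbb{E}[h_i(x;\xi_i)]$, $\xi_i$ is a random variable, and $h_i(\cdot;\xi_i):\mathbb{R}^n\to\mathbb{R}$ is continuous and convex (possibly nonsmooth) for every $\xi_i$. Block structure: $x=[x_1^\top,\dots,x_B^\top]^\top$ with $x_\ell\in\mathbb{R}^{n_\ell}$, $\sum_\ell n_\ell=n$, and $X=X_1\times\dots\times X_B$ with each $X_\ell\subseteq\mathbb{R}^{n_\ell}$ closed and convex. $\|\cdot\|$ is the 2-norm; $x_{i,\ell}$ (resp. $g_{i,\ell}$) is the $\ell$-th block of $x_i$ (resp. of $g_i$). Network: a strongly connected directed graph on $\{1,\dots,N\}$ with edge set $\mathcal{E}$ and weight matrix $W=(w_{ij})\in\mathbb{R}^{N\times N}$ with nonnegative entries; for $i\ne j$, $w_{ij}>0$ iff $(j,i)\in\mathcal{E}$; there is $\eta>0$ with $w_{ii}\ge\eta$ and $w_{ij}\ge\eta$ whenever $w_{ij}>0$; $W$ is doubly stochastic. Proximal mapping: $\omega_\ell:X_\ell\to\mathbb{R}$ is continuously differentiable and $\sigma_\ell$-strongly convex ($\sigma_\ell>0$); $\sigma=\min_\ell\sigma_\ell$; $\nu_\ell(a,b)=\omega_\ell(b)-\omega_\ell(a)-\langle\nabla\omega_\ell(a),b-a\rangle$ for $a,b\in X_\ell$; $\mathrm{prox}_\ell(a,b,c)=\arg\min_{u\in X_\ell}\{\langle b,u\rangle+\frac1c\nu_\ell(a,u)\}$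 for $a\in X_\ell$, $b\in\mathbb{R}^{n_\ell}$, $c>0$. Distributed Block Proximal Method: each agent $i$ starts from a random, bounded $x_i^0\in X$. For $t=0,1,\dots$ put $y_i^t=\sum_{j=1}^Nw_{ij}x_j^t$. If $s_i^t=1$ (awake): $x_{i,\ell}^{t+1}=\mathrm{prox}_\ell(y_{i,\ell}^t,g_{i,\ell}(y_i^t;\xi_i^t),\alpha_i^t)$ for $\ell=\ell_i^t$ and $x_{i,\ell}^{t+1}=x_{i,\ell}^t$ for $\ell\ne\ell_i^t$. If $s_i^t=0$ (idle): $x_i^{t+1}=x_i^t$. Here $g_i(x;\xi)\in\partial h_i(x;\xi)$ is a (whole) subgradient and $\alpha_i^t>0$ are local stepsizes. Random variables: $s_i^t\in\{0,1\}$ with $P(s_i^t=1)=p_{i,on}\in(0,1]$; $\ell_i^t\in\{1,\dots,B\}$ with $P(\ell_i^t=\ell)=p_{i,\ell}>0$; $\xi_i^t$ is distributed as $\xi_i$. For each $i$, the variables $\ell_i^t$ and $s_i^t$ are i.i.d. over $t$; for each $t$, the variables $s_i^t,\ell_i^t,\xi_i^t$ ($i=1,\dots,N$) are independent of each other; the variables drawn at iteration $t$ are independent of the initial conditions and of those drawn at previous iterations. Notation: $a_M^t=\max_i\alpha_i^t$; $\bar x^t=\frac1N\sum_{i=1}^Nx_i^t$. *)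

theory Defs
  imports "HOL-Probability.Probability"
begin

text \<open>
  The space \<open>R^n = R^{n_1} \<times> \<dots> \<times> R^{n_B}\<close> is \<open>real ^ 'n\<close> with a map \<open>blk\<close> that sends each coordinate
  to the number of its block, so \<open>n_\<ell>\<close> is the number of coordinates sent to \<open>\<ell>\<close>. The factor
  \<open>R^{n_\<ell>}\<close> is identified with the coordinate subspace \<open>block_space blk \<ell>\<close> of \<open>real ^ 'n\<close>
  (same norm, inner product and topology); blocks of vectors, the sets \<open>X_\<ell>\<close> and the
  gradients of the \<open>\<omega>_\<ell>\<close> live in it.
\<close>

definition block :: "('n::finite \<Rightarrow> nat) \<Rightarrow> nat \<Rightarrow> real ^ 'n \<Rightarrow> real ^ 'n" where
  "block blk l u = (\<chi> k. if blk k = l then u $ k else 0)"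

definition block_space :: "('n::finite \<Rightarrow> nat) \<Rightarrow> nat \<Rightarrow> (real ^ 'n) set" where
  "block_space blk l = {u. \<forall>k. blk k \<noteq> l \<longrightarrow> u $ k = 0}"

definition block_product ::
    "('n::finite \<Rightarrow> nat) \<Rightarrow> nat \<Rightarrow> (nat \<Rightarrow> (real ^ 'n) set) \<Rightarrow> (real ^ 'n) set" where
  "block_product blk B Xs = {u. \<forall>l\<in>{1..B}. block blk l u \<in> Xs l}"

definition subdifferential :: "('a::real_inner \<Rightarrow> real) \<Rightarrow> 'a \<Rightarrow> 'a set" where
  "subdifferential f u = {v. \<forall>w. f w \<ge> f u + v \<bullet> (w - u)}"

definition strongly_convex_on :: "'a::real_inner set \<Rightarrow> real \<Rightarrow> ('a \<Rightarrow> real) \<Rightarrow> bool" where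
  "strongly_convex_on S m f \<longleftrightarrow> convex S \<and>
     (\<forall>u\<in>S. \<forall>v\<in>S. \<forall>c\<in>{0..1}. f (c *\<^sub>R u + (1 - c) *\<^sub>R v)
        \<le> c * f u + (1 - c) * f v - m / 2 * c * (1 - c) * (norm (u - v))\<^sup>2)"

text \<open>
  The set \<open>S\<close> may have empty interior, so the derivative is taken within \<open>S\<close>. Then the gradient
  \<open>df\<close> need not be unique, but its inner product with \<open>b - a\<close> is, for \<open>a\<close> and \<open>b\<close> in a convex set \<open>S\<close>; hence
  \<open>bregman\<close> does not depend on the choice of \<open>df\<close>.
\<close>

definition C1_gradient_on ::
    "'a::real_inner set \<Rightarrow> ('a \<Rightarrow> real) \<Rightarrow> ('a \<Rightarrow> 'a) \<Rightarrow> bool" where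
  "C1_gradient_on S f df \<longleftrightarrow> continuous_on S df \<and>
     (\<forall>a\<in>S. (f has_derivative (\<lambda>v. df a \<bullet> v)) (at a within S))"

definition bregman ::
    "('a::real_inner \<Rightarrow> real) \<Rightarrow> ('a \<Rightarrow> 'a) \<Rightarrow> 'a \<Rightarrow> 'a \<Rightarrow> real" where
  "bregman f df a b = f b - f a - df a \<bullet> (b - a)"

definition prox ::
    "'a::real_inner set \<Rightarrow> ('a \<Rightarrow> real) \<Rightarrow> ('a \<Rightarrow> 'a) \<Rightarrow> 'a \<Rightarrow> 'a \<Rightarrow> real \<Rightarrow> 'a" where
  "prox S f df a b c = arg_min_on (\<lambda>u. b \<bullet> u + 1 / c * bregman f df a u) S"

locale network =
  fixes N :: nat
    and E :: "(nat \<times> nat) set"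
    and W :: "nat \<Rightarrow> nat \<Rightarrow> real"
  assumes N_pos: "N \<ge> 1"
    and edges: "E \<subseteq> {1..N} \<times> {1..N}"
    and strongly_connected: "\<And>i j. i \<in> {1..N} \<Longrightarrow> j \<in> {1..N} \<Longrightarrow> (i, j) \<in> E\<^sup>*"
    and W_nonneg: "\<And>i j. i \<in> {1..N} \<Longrightarrow> j \<in> {1..N} \<Longrightarrow> W i j \<ge> 0"
    and W_edges: "\<And>i j. i \<in> {1..N} \<Longrightarrow> j \<in> {1..N} \<Longrightarrow> i \<noteq> j \<Longrightarrow> W i j > 0 \<longleftrightarrow> (j, i) \<in> E"
    and W_lower: "\<exists>\<eta>>0. \<forall>i\<in>{1..N}. W i i \<ge> \<eta> \<and> (\<forall>j\<in>{1..N}. W i j > 0 \<longrightarrow> W i j \<ge> \<eta>)"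
    and W_rows: "\<And>i. i \<in> {1..N} \<Longrightarrow> (\<Sum>j=1..N. W i j) = 1"
    and W_columns: "\<And>j. j \<in> {1..N} \<Longrightarrow> (\<Sum>i=1..N. W i j) = 1"

text \<open>
  \<open>D i\<close> is the law of the random variable \<open>\<xi>_i\<close>, so that \<open>f_i(u) = \<integral> h_i(u; z) D_i(dz)\<close>. The joint
  measurability of \<open>g i\<close> is what makes \<open>g_i(y; \<xi>)\<close> a random vector for random \<open>y\<close> and \<open>\<xi>\<close>.
\<close>

locale block_problem =
  fixes N B :: nat
    and blk :: "'n::finite \<Rightarrow> nat"
    and Xs :: "nat \<Rightarrow> (real ^ 'n) set"
    and D :: "nat \<Rightarrow> 'z measure"
    and h :: "nat \<Rightarrow> real ^ 'n \<Rightarrow> 'z \<Rightarrow> real"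
    and g :: "nat \<Rightarrow> real ^ 'n \<Rightarrow> 'z \<Rightarrow> real ^ 'n"
    and \<omega> :: "nat \<Rightarrow> real ^ 'n \<Rightarrow> real"
    and d\<omega> :: "nat \<Rightarrow> real ^ 'n \<Rightarrow> real ^ 'n"
    and \<sigma> :: "nat \<Rightarrow> real"
  assumes blk: "\<And>k. blk k \<in> {1..B}"
    and Xs_block: "\<And>l. l \<in> {1..B} \<Longrightarrow> Xs l \<subseteq> block_space blk l"
    and Xs_closed: "\<And>l. l \<in> {1..B} \<Longrightarrow> closed (Xs l)"
    and Xs_convex: "\<And>l. l \<in> {1..B} \<Longrightarrow> convex (Xs l)"
    and D_prob: "\<And>i. i \<in> {1..N} \<Longrightarrow> prob_space (D i)"
    and h_continuous: "\<And>i z. i \<in> {1..N} \<Longrightarrow> z \<in> space (D i) \<Longrightarrow> continuous_on UNIV (\<lambda>u. h i u z)"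
    and h_convex: "\<And>i z. i \<in> {1..N} \<Longrightarrow> z \<in> space (D i) \<Longrightarrow> convex_on UNIV (\<lambda>u. h i u z)"
    and h_integrable: "\<And>i u. i \<in> {1..N} \<Longrightarrow> u \<in> block_product blk B Xs \<Longrightarrow> integrable (D i) (h i u)"
    and g_subgradient: "\<And>i u z. i \<in> {1..N} \<Longrightarrow> u \<in> block_product blk B Xs \<Longrightarrow> z \<in> space (D i) \<Longrightarrow>
          g i u z \<in> subdifferential (\<lambda>v. h i v z) u"
    and g_measurable: "\<And>i. i \<in> {1..N} \<Longrightarrow>
          (\<lambda>(u, z). g i u z)
            \<in> borel_measurable (restrict_space borel (block_product blk B Xs) \<Otimes>\<^sub>M D i)"
    and \<omega>_C1: "\<And>l. l \<in> {1..B} \<Longrightarrow> C1_gradient_on (Xs l) (\<omega> l) (d\<omega> l)"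
    and d\<omega>_block: "\<And>l a. l \<in> {1..B} \<Longrightarrow> a \<in> Xs l \<Longrightarrow> d\<omega> l a \<in> block_space blk l"
    and \<sigma>_pos: "\<And>l. l \<in> {1..B} \<Longrightarrow> \<sigma> l > 0"
    and \<omega>_strongly_convex: "\<And>l. l \<in> {1..B} \<Longrightarrow> strongly_convex_on (Xs l) (\<sigma> l) (\<omega> l)"

datatype draw = Awake | Block | Sample

text \<open>
  The sigma-algebra generated by \<open>s_i^t\<close>, \<open>\<ell>_i^t\<close> or \<open>\<xi>_i^t\<close>. Independence is stated for these
  sigma-algebras because the three kinds of variables have different types.
\<close>

fun draw_events ::
    "'e measure \<Rightarrow> (nat \<Rightarrow> 'z measure) \<Rightarrow> (nat \<Rightarrow> nat \<Rightarrow> 'e \<Rightarrow> nat) \<Rightarrow> (nat \<Rightarrow> nat \<Rightarrow> 'e \<Rightarrow> nat)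
       \<Rightarrow> (nat \<Rightarrow> nat \<Rightarrow> 'e \<Rightarrow> 'z) \<Rightarrow> nat \<Rightarrow> draw \<times> nat \<Rightarrow> 'e set set" where
  "draw_events P D s ell \<xi> t (Awake, i) = sets (vimage_algebra (space P) (s i t) (count_space UNIV))"
| "draw_events P D s ell \<xi> t (Block, i) = sets (vimage_algebra (space P) (ell i t) (count_space UNIV))"
| "draw_events P D s ell \<xi> t (Sample, i) = sets (vimage_algebra (space P) (\<xi> i t) (D i))"

text \<open>
  \<open>x i t\<close>, \<open>s i t\<close>, \<open>ell i t\<close>, \<dots> stand for \<open>x_i^t\<close>, \<open>s_i^t\<close>, \<open>\<ell>_i^t\<close>, \<dots>, and \<open>e\<close> is the
  sample point.
\<close>

locale distributed_block_proximal =
  prob_space P + network N E W + block_problem N B blk Xs D h g \<omega> d\<omega> \<sigma>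
  for P :: "'e measure"
    and N :: nat
    and E :: "(nat \<times> nat) set"
    and W :: "nat \<Rightarrow> nat \<Rightarrow> real"
    and B :: nat
    and blk :: "'n::finite \<Rightarrow> nat"
    and Xs :: "nat \<Rightarrow> (real ^ 'n) set"
    and D :: "nat \<Rightarrow> 'z measure"
    and h :: "nat \<Rightarrow> real ^ 'n \<Rightarrow> 'z \<Rightarrow> real"
    and g :: "nat \<Rightarrow> real ^ 'n \<Rightarrow> 'z \<Rightarrow> real ^ 'n"
    and \<omega> :: "nat \<Rightarrow> real ^ 'n \<Rightarrow> real"
    and d\<omega> :: "nat \<Rightarrow> real ^ 'n \<Rightarrow> real ^ 'n"
    and \<sigma> :: "nat \<Rightarrow> real" +
  fixes p_on :: "nat \<Rightarrow> real"
    and p :: "nat \<Rightarrow> nat \<Rightarrow> real"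
    and s :: "nat \<Rightarrow> nat \<Rightarrow> 'e \<Rightarrow> nat"
    and ell :: "nat \<Rightarrow> nat \<Rightarrow> 'e \<Rightarrow> nat"
    and \<xi> :: "nat \<Rightarrow> nat \<Rightarrow> 'e \<Rightarrow> 'z"
    and \<alpha> :: "nat \<Rightarrow> nat \<Rightarrow> real"
    and x y :: "nat \<Rightarrow> nat \<Rightarrow> 'e \<Rightarrow> real ^ 'n"
  assumes p_on: "\<And>i. i \<in> {1..N} \<Longrightarrow> 0 < p_on i \<and> p_on i \<le> 1"
    and p_pos: "\<And>i l. i \<in> {1..N} \<Longrightarrow> l \<in> {1..B} \<Longrightarrow> p i l > 0"
    and s_measurable: "\<And>i t. i \<in> {1..N} \<Longrightarrow> random_variable (count_space UNIV) (s i t)"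
    and s_range: "\<And>i t e. i \<in> {1..N} \<Longrightarrow> e \<in> space P \<Longrightarrow> s i t e \<in> {0, 1}"
    and s_prob: "\<And>i t. i \<in> {1..N} \<Longrightarrow> prob {e \<in> space P. s i t e = 1} = p_on i"
    and ell_measurable: "\<And>i t. i \<in> {1..N} \<Longrightarrow> random_variable (count_space UNIV) (ell i t)"
    and ell_range: "\<And>i t e. i \<in> {1..N} \<Longrightarrow> e \<in> space P \<Longrightarrow> ell i t e \<in> {1..B}"
    and ell_prob: "\<And>i t l. i \<in> {1..N} \<Longrightarrow> l \<in> {1..B} \<Longrightarrow> prob {e \<in> space P. ell i t e = l} = p i l"
    and \<xi>_measurable: "\<And>i t. i \<in> {1..N} \<Longrightarrow> random_variable (D i) (\<xi> i t)"
    and \<xi>_distr: "\<And>i t. i \<in> {1..N} \<Longrightarrow> distr P (D i) (\<xi> i t) = D i"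
    and s_indep: "\<And>i. i \<in> {1..N} \<Longrightarrow> indep_vars (\<lambda>_. count_space UNIV) (s i) UNIV"
    and ell_indep: "\<And>i. i \<in> {1..N} \<Longrightarrow> indep_vars (\<lambda>_. count_space UNIV) (ell i) UNIV"
    and draws_indep: "\<And>t. indep_sets (draw_events P D s ell \<xi> t) (UNIV \<times> {1..N})"
    and draws_indep_past: "\<And>t. indep_set
          (sigma_sets (space P) (\<Union>d\<in>UNIV \<times> {1..N}. draw_events P D s ell \<xi> t d))
          (sigma_sets (space P)
             ((\<Union>i\<in>{1..N}. sets (vimage_algebra (space P) (x i 0) borel)) \<union>
              (\<Union>\<tau>\<in>{..<t}. \<Union>d\<in>UNIV \<times> {1..N}. draw_events P D s ell \<xi> \<tau> d)))"
    and stepsize_pos: "\<And>i t. i \<in> {1..N} \<Longrightarrow> \<alpha> i t > 0"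
    and init_measurable: "\<And>i. i \<in> {1..N} \<Longrightarrow> random_variable borel (x i 0)"
    and init_bounded: "\<And>i. i \<in> {1..N} \<Longrightarrow> \<exists>K. \<forall>e\<in>space P. norm (x i 0 e) \<le> K"
    and init_feasible: "\<And>i e. i \<in> {1..N} \<Longrightarrow> e \<in> space P \<Longrightarrow> x i 0 e \<in> block_product blk B Xs"
    and y_def: "\<And>i t e. i \<in> {1..N} \<Longrightarrow> e \<in> space P \<Longrightarrow> y i t e = (\<Sum>j=1..N. W i j *\<^sub>R x j t e)"
    and x_awake: "\<And>i t e l. i \<in> {1..N} \<Longrightarrow> e \<in> space P \<Longrightarrow> l \<in> {1..B} \<Longrightarrow> s i t e = 1 \<Longrightarrow>
          block blk l (x i (Suc t) e) =
            (if l = ell i t e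
             then prox (Xs l) (\<omega> l) (d\<omega> l)
                    (block blk l (y i t e)) (block blk l (g i (y i t e) (\<xi> i t e))) (\<alpha> i t)
             else block blk l (x i t e))"
    and x_idle: "\<And>i t e. i \<in> {1..N} \<Longrightarrow> e \<in> space P \<Longrightarrow> s i t e = 0 \<Longrightarrow> x i (Suc t) e = x i t e"

end

theory Submission
  imports Defs
begin

text \<open>
  Fix a block \<open>l\<close> and measure the disagreement of the agents on it by the largest distance between two of
  them. A proximal step moves a point by at most the stepsize times the subgradient norm over \<open>\<sigma>\<close>, so up to
  such errors an iteration replaces the block of every agent by a convex combination of the agents' blocks,
  and this never increases the disagreement. The random mixing matrices need not be doubly
  stochastic, but with a probability bounded below all agents are awake and choose \<open>l\<close>, independently
  of the past, and then the block is mixed by \<open>W\<close> itself. Some power \<open>W^L\<close> has a positive column and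
  contracts the disagreement. A weighted sum of the expected disagreements of \<open>W^k x\<close>, \<open>k < L\<close>,
  therefore decays geometrically up to the errors, whose expectations are bounded by \<open>a_M G / \<sigma>\<close>
  because the sample drawn at time \<open>t\<close> is independent of \<open>y^t\<close>.
\<close>

section \<open>Proximal mappings of strongly convex functions\<close>

text \<open>Letting \<open>c\<close> tend to 0 from the right removes the factor
  \<open>1 - c\<close> that strong convexity leaves along a segment.\<close>

lemma le_of_le_scaled_near_one:
  fixes a b d :: real
  assumes "\<And>c. 0 < c \<Longrightarrow> c < 1 \<Longrightarrow> a \<le> b - d * (1 - c)"
  shows "a \<le> b - d"
proof (rule tendsto_le)
  show "((\<lambda>c. b - d * (1 - c)) \<longlongrightarrow> b - d) (at_right (0::real))"
    by (auto intro!: tendsto_eq_intros)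
  show "((\<lambda>c. a) \<longlongrightarrow> a) (at_right (0::real))" by simp
  show "\<forall>\<^sub>F c in at_right (0::real). a \<le> b - d * (1 - c)"
    unfolding eventually_at_right_field using assms by (intro exI[of _ 1]) auto
qed simp

lemma strongly_convex_onD:
  assumes "strongly_convex_on S m f" "u \<in> S" "v \<in> S" "0 \<le> c" "c \<le> 1"
  shows "f (u + c *\<^sub>R (v - u)) \<le> (1 - c) * f u + c * f v - m / 2 * c * (1 - c) * (norm (v - u))\<^sup>2"
proof -
  have "u + c *\<^sub>R (v - u) = c *\<^sub>R v + (1 - c) *\<^sub>R u" by (simp add: algebra_simps)
  then show ?thesis using assms unfolding strongly_convex_on_def by (auto simp: add.commute)
qed

lemma convex_segment_mem:
  assumes "convex S" "u \<in> S" "v \<in> S" "0 \<le> c" "c \<le> 1"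
  shows "u + c *\<^sub>R (v - u) \<in> S"
  using convexD_alt[OF assms] by (simp add: algebra_simps)

text \<open>Strong convexity bounds the difference quotients of \<open>f\<close> along the segment
  from \<open>u\<close> to \<open>v\<close>, and in the limit they become
  \<open>d \<bullet> (v - u)\<close>. The derivative is only given within \<open>S\<close>, so the
  chain rule is applied to the segment as a map on \<open>{0..1}\<close> with image in
  \<open>S\<close>.\<close>

lemma strongly_convex_gradient_ineq:
  assumes sc: "strongly_convex_on S m f"
    and df: "(f has_derivative (\<lambda>v. d \<bullet> v)) (at u within S)"
    and u: "u \<in> S" and v: "v \<in> S"
  shows "f v \<ge> f u + d \<bullet> (v - u) + m / 2 * (norm (v - u))\<^sup>2"
proof -
  have cvx: "convex S" using sc by (simp add: strongly_convex_on_def)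
  let ?\<gamma> = "\<lambda>c::real. u + c *\<^sub>R (v - u)"
  let ?q = "m / 2 * (norm (v - u))\<^sup>2"
  have "?\<gamma> ` {0..1} \<subseteq> S" using convex_segment_mem[OF cvx u v] by auto
  then have "(f has_derivative (\<lambda>v. d \<bullet> v)) (at (?\<gamma> 0) within ?\<gamma> ` {0..1})"
    using df by (auto intro: has_derivative_subset)
  moreover have "(?\<gamma> has_derivative (\<lambda>c. c *\<^sub>R (v - u))) (at 0 within {0..1})"
    by (auto intro!: derivative_eq_intros)
  ultimately have "((\<lambda>c. f (?\<gamma> c)) has_derivative (\<lambda>c. d \<bullet> (c *\<^sub>R (v - u)))) (at 0 within {0..1})"
    by (rule has_derivative_in_compose[rotated])
  then have "((\<lambda>c. f (?\<gamma> c)) has_field_derivative d \<bullet> (v - u)) (at 0 within {0..1})"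
    unfolding has_field_derivative_def by (rule has_derivative_eq_rhs) (simp add: fun_eq_iff)
  then have lim: "((\<lambda>c. (f (?\<gamma> c) - f u) / c) \<longlongrightarrow> d \<bullet> (v - u)) (at_right 0)"
    by (simp add: has_field_derivative_iff at_within_Icc_at_right)
  have "d \<bullet> (v - u) \<le> f v - f u - ?q"
  proof (rule tendsto_le[OF _ _ lim])
    show "((\<lambda>c. f v - f u - ?q * (1 - c)) \<longlongrightarrow> f v - f u - ?q) (at_right (0::real))"
      by (auto intro!: tendsto_eq_intros)
    have "(f (?\<gamma> c) - f u) / c \<le> f v - f u - ?q * (1 - c)" if "0 < c" "c < 1" for c
      using strongly_convex_onD[OF sc u v, of c] that by (simp add: field_simps)
    then show "\<forall>\<^sub>F c in at_right 0. (f (?\<gamma> c) - f u) / c \<le> f v - f u - ?q * (1 - c)"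
      unfolding eventually_at_right_field by (intro exI[of _ 1]) auto
  qed simp
  then show ?thesis by simp
qed

definition minimizes_on :: "'a set \<Rightarrow> ('a \<Rightarrow> real) \<Rightarrow> 'a \<Rightarrow> bool" where
  "minimizes_on S f u \<longleftrightarrow> u \<in> S \<and> (\<forall>v\<in>S. f u \<le> f v)"

lemma arg_min_on_minimizes:
  assumes "\<exists>u. minimizes_on S f u"
  shows "minimizes_on S f (arg_min_on f S)"
proof -
  have "minimizes_on S f = is_arg_min f (\<lambda>x. x \<in> S)"
    by (auto simp: fun_eq_iff is_arg_min_def minimizes_on_def not_less)
  then show ?thesis using someI_ex[OF assms] by (simp add: arg_min_on_def arg_min_def)
qed

text \<open>For strongly convex \<open>f\<close> this is the gradient at \<open>z\<close> of the
  convex conjugate of \<open>f\<close> restricted to \<open>S\<close>. All dependence of a proximal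
  point on its centre and subgradient passes through the tilt \<open>z\<close>.\<close>

definition tilted_min :: "'a::real_inner set \<Rightarrow> ('a \<Rightarrow> real) \<Rightarrow> 'a \<Rightarrow> 'a" where
  "tilted_min S f z = arg_min_on (\<lambda>u. f u - z \<bullet> u) S"

text \<open>The two objectives differ by the positive factor \<open>c\<close> and a constant in
  \<open>u\<close>, so they have the same minimizers, and the choice operator behind
  \<open>arg_min\<close> returns the same point.\<close>

lemma prox_eq_tilted_min:
  assumes "c > 0"
  shows "prox S f df a b c = tilted_min S f (df a - c *\<^sub>R b)"
proof -
  have "is_arg_min (\<lambda>u. b \<bullet> u + 1 / c * bregman f df a u) P u
      \<longleftrightarrow> is_arg_min (\<lambda>u. f u - (df a - c *\<^sub>R b) \<bullet> u) P u" for P u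
  proof -
    have "b \<bullet> u + 1 / c * bregman f df a u
        = (f u - (df a - c *\<^sub>R b) \<bullet> u) / c + (df a \<bullet> a - f a) / c" for u
      using assms by (simp add: bregman_def field_simps inner_diff_left inner_diff_right inner_add_left)
    then show ?thesis using assms by (simp add: is_arg_min_def divide_less_cancel)
  qed
  then show ?thesis by (simp add: prox_def tilted_min_def arg_min_on_def arg_min_def)
qed

text \<open>The minimum at \<open>u\<close> is compared with the points
  \<open>u + c *\<^sub>R (v - u)\<close>; dividing by \<open>c\<close> and letting \<open>c\<close>
  tend to 0 keeps the full quadratic gain.\<close>

lemma tilted_minimizer_growth:
  assumes sc: "strongly_convex_on S m f"
    and u: "minimizes_on S (\<lambda>u. f u - z \<bullet> u) u" and v: "v \<in> S"
  shows "f u - z \<bullet> u \<le> f v - z \<bullet> v - m / 2 * (norm (v - u))\<^sup>2"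
proof (rule le_of_le_scaled_near_one)
  fix c :: real assume c: "0 < c" "c < 1"
  have uS: "u \<in> S" using u by (simp add: minimizes_on_def)
  have "u + c *\<^sub>R (v - u) \<in> S"
    using sc uS v c convex_segment_mem[of S u v c] by (auto simp: strongly_convex_on_def)
  then have "f u - z \<bullet> u \<le> f (u + c *\<^sub>R (v - u)) - z \<bullet> (u + c *\<^sub>R (v - u))"
    using u by (auto simp: minimizes_on_def)
  also have "\<dots> \<le> (1 - c) * f u + c * f v - m / 2 * c * (1 - c) * (norm (v - u))\<^sup>2 - z \<bullet> (u + c *\<^sub>R (v - u))"
    using strongly_convex_onD[OF sc uS v, of c] c by simp
  finally have "c * (f u - z \<bullet> u) \<le> c * (f v - z \<bullet> v - m / 2 * (norm (v - u))\<^sup>2 * (1 - c))"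
    by (simp add: algebra_simps inner_add_right inner_diff_right)
  then show "f u - z \<bullet> u \<le> f v - z \<bullet> v - m / 2 * (norm (v - u))\<^sup>2 * (1 - c)"
    using c by simp
qed

text \<open>Adding the growth inequality of each minimizer, taken at the other one, cancels
  \<open>f\<close> and leaves \<open>m * (norm (u - v))\<^sup>2\<close> bounded by an inner product,
  to which Cauchy-Schwarz applies. This yields both the continuity of \<open>tilted_min\<close> and
  the length of a proximal step.\<close>

lemma tilted_minimizers_close:
  assumes sc: "strongly_convex_on S m f" and m: "m > 0"
    and u: "minimizes_on S (\<lambda>u. f u - z \<bullet> u) u" and v: "minimizes_on S (\<lambda>u. f u - w \<bullet> u) v"
  shows "norm (u - v) \<le> norm (z - w) / m"
proof -
  have "f u - z \<bullet> u \<le> f v - z \<bullet> v - m / 2 * (norm (v - u))\<^sup>2"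
    using tilted_minimizer_growth[OF sc u] v by (simp add: minimizes_on_def)
  moreover have "f v - w \<bullet> v \<le> f u - w \<bullet> u - m / 2 * (norm (u - v))\<^sup>2"
    using tilted_minimizer_growth[OF sc v] u by (simp add: minimizes_on_def)
  ultimately have "m * (norm (u - v))\<^sup>2 \<le> (z - w) \<bullet> (u - v)"
    by (simp add: inner_diff_left inner_diff_right norm_minus_commute)
  also have "\<dots> \<le> norm (z - w) * norm (u - v)" by (rule norm_cauchy_schwarz)
  finally have "norm (u - v) * (m * norm (u - v)) \<le> norm (u - v) * norm (z - w)"
    by (simp add: power2_eq_square algebra_simps)
  then have "m * norm (u - v) \<le> norm (z - w)"
    by (cases "norm (u - v) = 0") (auto simp: mult_le_cancel_left)
  then show ?thesis using m by (simp add: field_simps)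
qed

text \<open>Tilting by the gradient at \<open>a\<close> makes \<open>a\<close> stationary, so
  \<open>a\<close> is the proximal point for the zero subgradient, the reference point of
  \<open>prox_dist_le\<close>.\<close>

lemma gradient_point_minimizes:
  assumes "strongly_convex_on S m f" "m > 0" "C1_gradient_on S f df" "a \<in> S"
  shows "minimizes_on S (\<lambda>u. f u - df a \<bullet> u) a"
  unfolding minimizes_on_def
proof (intro conjI ballI)
  fix v assume "v \<in> S"
  then have "f v \<ge> f a + df a \<bullet> (v - a) + m / 2 * (norm (v - a))\<^sup>2"
    using assms strongly_convex_gradient_ineq[of S m f "df a" a v] by (auto simp: C1_gradient_on_def)
  moreover have "m / 2 * (norm (v - a))\<^sup>2 \<ge> 0" using assms by simp
  ultimately show "f a - df a \<bullet> a \<le> f v - df a \<bullet> v" by (simp add: inner_diff_right)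
qed (use assms in simp)

lemma ex_tilted_minimizer:
  fixes S :: "'a::euclidean_space set"
  assumes sc: "strongly_convex_on S m f" and m: "m > 0" and C1: "C1_gradient_on S f df"
    and S: "closed S" "S \<noteq> {}"
  shows "\<exists>u. minimizes_on S (\<lambda>u. f u - z \<bullet> u) u"
proof -
  obtain a where a: "a \<in> S" using S by auto
  have cont: "continuous_on S (\<lambda>u. f u - z \<bullet> u)"
    using C1 unfolding C1_gradient_on_def
    by (intro continuous_intros has_derivative_continuous_on) auto
  \<comment> \<open>From this distance on, the quadratic growth around \<open>a\<close> outweighs
    the slope \<open>df a - z\<close> of the tilted function at \<open>a\<close>, so a minimizer
    over the compact set \<open>S \<inter> cball a r\<close> is global.\<close>
  define r where "r = 2 * norm (df a - z) / m"
  have far: "f a - z \<bullet> a \<le> f u - z \<bullet> u" if u: "u \<in> S" "u \<notin> cball a r" for u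
  proof -
    have "norm (u - a) \<ge> r" using u by (simp add: dist_norm norm_minus_commute)
    then have "m / 2 * norm (u - a) \<ge> norm (df a - z)" using m by (simp add: r_def field_simps)
    then have "norm (df a - z) * norm (u - a) \<le> m / 2 * norm (u - a) * norm (u - a)"
      by (rule mult_right_mono) simp
    moreover have "\<bar>(df a - z) \<bullet> (u - a)\<bar> \<le> norm (df a - z) * norm (u - a)"
      by (rule Cauchy_Schwarz_ineq2)
    moreover have "f u \<ge> f a + df a \<bullet> (u - a) + m / 2 * (norm (u - a))\<^sup>2"
      using strongly_convex_gradient_ineq[OF sc _ a u(1)] C1 a by (auto simp: C1_gradient_on_def)
    ultimately show ?thesis by (simp add: inner_diff_left inner_diff_right power2_eq_square algebra_simps)
  qed
  have r: "r \<ge> 0" using m by (simp add: r_def)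
  obtain u where u: "u \<in> S \<inter> cball a r" "\<And>v. v \<in> S \<inter> cball a r \<Longrightarrow> f u - z \<bullet> u \<le> f v - z \<bullet> v"
  proof -
    have "\<exists>u\<in>S \<inter> cball a r. \<forall>v\<in>S \<inter> cball a r. f u - z \<bullet> u \<le> f v - z \<bullet> v"
    proof (rule continuous_attains_inf)
      show "compact (S \<inter> cball a r)" using S by (intro closed_Int_compact) auto
      show "S \<inter> cball a r \<noteq> {}" using a r by auto
      show "continuous_on (S \<inter> cball a r) (\<lambda>u. f u - z \<bullet> u)"
        using cont by (rule continuous_on_subset) simp
    qed
    then show thesis using that by blast
  qed
  have "f u - z \<bullet> u \<le> f a - z \<bullet> a" using u(2)[of a] a r by simp
  then have "minimizes_on S (\<lambda>u. f u - z \<bullet> u) u"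
    unfolding minimizes_on_def using u far by fastforce
  then show ?thesis by blast
qed

context
  fixes S :: "'a::euclidean_space set" and m :: real and f :: "'a \<Rightarrow> real" and df :: "'a \<Rightarrow> 'a"
  assumes sc: "strongly_convex_on S m f" and m: "m > 0" and C1: "C1_gradient_on S f df"
    and closed_S: "closed S"
begin

lemma tilted_min_minimizes:
  "S \<noteq> {} \<Longrightarrow> minimizes_on S (\<lambda>u. f u - z \<bullet> u) (tilted_min S f z)"
  unfolding tilted_min_def
  by (intro arg_min_on_minimizes ex_tilted_minimizer[OF sc m C1 closed_S])

lemma continuous_on_tilted_min:
  assumes "S \<noteq> {}"
  shows "continuous_on UNIV (tilted_min S f)"
proof (rule lipschitz_on_continuous_on)
  show "(1 / m)-lipschitz_on UNIV (tilted_min S f)"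
    using m tilted_minimizers_close[OF sc m tilted_min_minimizes[OF assms] tilted_min_minimizes[OF assms]]
    by (auto simp: lipschitz_on_def dist_norm)
qed

lemma prox_mem: "c > 0 \<Longrightarrow> S \<noteq> {} \<Longrightarrow> prox S f df a b c \<in> S"
  using tilted_min_minimizes by (simp add: prox_eq_tilted_min minimizes_on_def)

text \<open>Both points are tilted minimizers, \<open>a\<close> for the tilt \<open>df a\<close> and
  the proximal point for \<open>df a - c *\<^sub>R b\<close>; the tilts differ by
  \<open>c *\<^sub>R b\<close>.\<close>

lemma prox_dist_le:
  assumes c: "c > 0" and a: "a \<in> S"
  shows "norm (prox S f df a b c - a) \<le> c * norm b / m"
proof -
  have "S \<noteq> {}" using a by auto
  then have "norm (tilted_min S f (df a - c *\<^sub>R b) - a) \<le> norm ((df a - c *\<^sub>R b) - df a) / m"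
    using gradient_point_minimizes[OF sc m C1 a]
    by (intro tilted_minimizers_close[OF sc m] tilted_min_minimizes)
  then show ?thesis using c by (simp add: prox_eq_tilted_min)
qed

lemma borel_measurable_prox:
  assumes c: "c > 0"
    and a: "a \<in> borel_measurable M" "\<And>e. e \<in> space M \<Longrightarrow> a e \<in> S"
    and b: "b \<in> borel_measurable M"
  shows "(\<lambda>e. prox S f df (a e) (b e) c) \<in> borel_measurable M"
proof (cases "space M = {}")
  \<comment> \<open>A point of \<open>M\<close> gives a point of \<open>S\<close>, so that
    minimizers exist; on an empty space the claim is trivial.\<close>
  case False
  then have S: "S \<noteq> {}" using a by auto
  have "df \<in> borel_measurable (restrict_space borel S)"
    using C1 by (intro borel_measurable_continuous_on_restrict) (simp add: C1_gradient_on_def)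
  moreover have "a \<in> measurable M (restrict_space borel S)"
    using a by (intro measurable_restrict_space2) auto
  ultimately have [measurable]: "(\<lambda>e. df (a e)) \<in> borel_measurable M"
    by (rule measurable_compose[rotated])
  have [measurable]: "tilted_min S f \<in> borel_measurable borel"
    using continuous_on_tilted_min[OF S] by (rule borel_measurable_continuous_onI)
  note b[measurable]
  show ?thesis unfolding prox_eq_tilted_min[OF c] by measurable
qed (simp add: measurable_def)

end

section \<open>Disagreement under stochastic mixing\<close>

text \<open>The diameter of the agents' values. No row-stochastic matrix increases it, whereas the
  distance to the average can grow when the matrix is not doubly stochastic.\<close>

definition disagreement :: "nat \<Rightarrow> (nat \<Rightarrow> 'a::real_normed_vector) \<Rightarrow> real" where
  "disagreement N u = Max ((\<lambda>(i, j). norm (u i - u j)) ` ({1..N} \<times> {1..N}))"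

lemma norm_diff_le_disagreement:
  "i \<in> {1..N} \<Longrightarrow> j \<in> {1..N} \<Longrightarrow> norm (u i - u j) \<le> disagreement N u"
  unfolding disagreement_def by (intro Max_ge) auto

lemma disagreement_le:
  assumes "N \<ge> 1" "\<And>i j. i \<in> {1..N} \<Longrightarrow> j \<in> {1..N} \<Longrightarrow> norm (u i - u j) \<le> c"
  shows "disagreement N u \<le> c"
  unfolding disagreement_def using assms by (subst Max_le_iff) auto

lemma disagreement_nonneg: "N \<ge> 1 \<Longrightarrow> 0 \<le> disagreement N u"
  using norm_diff_le_disagreement[of 1 N 1 u] by simp

lemma disagreement_cong:
  "(\<And>i. i \<in> {1..N} \<Longrightarrow> u i = v i) \<Longrightarrow> disagreement N u = disagreement N v"
  unfolding disagreement_def by (intro arg_cong[where f = Max] image_cong) auto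

lemma disagreement_triangle:
  assumes "N \<ge> 1"
  shows "disagreement N (\<lambda>i. u i + v i) \<le> disagreement N u + disagreement N v"
proof (rule disagreement_le[OF assms])
  fix i j assume "i \<in> {1..N}" "j \<in> {1..N}"
  then have "norm (u i - u j) + norm (v i - v j) \<le> disagreement N u + disagreement N v"
    by (intro add_mono norm_diff_le_disagreement)
  moreover have "norm (u i + v i - (u j + v j)) \<le> norm (u i - u j) + norm (v i - v j)"
    using norm_triangle_ineq[of "u i - u j" "v i - v j"] by (simp add: algebra_simps)
  ultimately show "norm (u i + v i - (u j + v j)) \<le> disagreement N u + disagreement N v"
    by linarith
qed

lemma disagreement_le_sum_norm:
  assumes "N \<ge> 1"
  shows "disagreement N u \<le> 2 * (\<Sum>i=1..N. norm (u i))"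
proof (rule disagreement_le[OF assms])
  fix i j assume "i \<in> {1..N}" "j \<in> {1..N}"
  then have "norm (u i) \<le> (\<Sum>i=1..N. norm (u i))" "norm (u j) \<le> (\<Sum>i=1..N. norm (u i))"
    by (auto intro!: member_le_sum)
  then show "norm (u i - u j) \<le> 2 * (\<Sum>i=1..N. norm (u i))"
    using norm_triangle_ineq4[of "u i" "u j"] by linarith
qed

text \<open>
  If \<open>k\<close> and \<open>l\<close> are drawn independently from the rows \<open>i\<close> and \<open>j\<close> of \<open>A\<close>, both equal \<open>m\<close> with probability
  at least \<open>d^2\<close>, and then \<open>u k - u l\<close> vanishes.
\<close>

lemma disagreement_stochastic_le:
  fixes A :: "nat \<Rightarrow> nat \<Rightarrow> real"
  assumes N: "N \<ge> 1" and m: "m \<in> {1..N}"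
    and A0: "\<And>i j. i \<in> {1..N} \<Longrightarrow> j \<in> {1..N} \<Longrightarrow> A i j \<ge> 0"
    and A1: "\<And>i. i \<in> {1..N} \<Longrightarrow> (\<Sum>j=1..N. A i j) = 1"
    and d: "0 \<le> d" "\<And>i. i \<in> {1..N} \<Longrightarrow> d \<le> A i m"
  shows "disagreement N (\<lambda>i. \<Sum>j=1..N. A i j *\<^sub>R u j) \<le> (1 - d\<^sup>2) * disagreement N u"
proof (rule disagreement_le[OF N])
  fix i j assume i: "i \<in> {1..N}" and j: "j \<in> {1..N}"
  let ?D = "disagreement N u" and ?J = "{1..N}"
  have "(\<Sum>k\<in>?J. \<Sum>l\<in>?J. (A i k * A j l) *\<^sub>R (u k - u l))
      = (\<Sum>k\<in>?J. A i k *\<^sub>R u k) - (\<Sum>k\<in>?J. A j k *\<^sub>R u k)"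
  proof -
    have "(\<Sum>k\<in>?J. \<Sum>l\<in>?J. (A i k * A j l) *\<^sub>R u k) = (\<Sum>k\<in>?J. A i k *\<^sub>R u k)"
      using A1[OF j] by (simp add: scaleR_sum_left[symmetric] sum_distrib_left[symmetric])
    moreover have "(\<Sum>k\<in>?J. \<Sum>l\<in>?J. (A i k * A j l) *\<^sub>R u l) = (\<Sum>k\<in>?J. A j k *\<^sub>R u k)"
      using A1[OF i] by (subst sum.swap)
        (simp add: scaleR_sum_left[symmetric] sum_distrib_right[symmetric])
    ultimately show ?thesis by (simp add: scaleR_diff_right sum_subtractf)
  qed
  then have "norm ((\<Sum>k\<in>?J. A i k *\<^sub>R u k) - (\<Sum>k\<in>?J. A j k *\<^sub>R u k))
      = norm (\<Sum>(k, l)\<in>?J \<times> ?J. (A i k * A j l) *\<^sub>R (u k - u l))"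
    by (simp add: sum.cartesian_product)
  also have "\<dots> \<le> (\<Sum>(k, l)\<in>?J \<times> ?J. A i k * A j l * norm (u k - u l))"
    using A0 i j by (intro sum_norm_le) auto
  also have "\<dots> \<le> (\<Sum>(k, l)\<in>?J \<times> ?J. A i k * A j l * ?D - (if (k, l) = (m, m) then A i k * A j l * ?D else 0))"
  proof (intro sum_mono, clarify)
    fix k l assume kl: "k \<in> ?J" "l \<in> ?J"
    have "A i k * A j l * norm (u k - u l) \<le> A i k * A j l * ?D"
      using norm_diff_le_disagreement[OF kl, of u] A0 i j kl by (intro mult_left_mono) auto
    then show "A i k * A j l * norm (u k - u l)
        \<le> A i k * A j l * ?D - (if (k, l) = (m, m) then A i k * A j l * ?D else 0)"
      by auto
  qed
  also have "\<dots> = (\<Sum>(k, l)\<in>?J \<times> ?J. A i k * A j l * ?D) - A i m * A j m * ?D"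
  proof -
    have "(\<Sum>(k, l)\<in>?J \<times> ?J. if (k, l) = (m, m) then A i k * A j l * ?D else 0)
        = (\<Sum>kl\<in>?J \<times> ?J. if kl = (m, m) then A i m * A j m * ?D else 0)"
      by (intro sum.cong) (auto split: if_splits)
    also have "\<dots> = A i m * A j m * ?D" using m by (simp add: sum.delta)
    finally show ?thesis by (simp add: sum_subtractf case_prod_beta')
  qed
  also have "(\<Sum>(k, l)\<in>?J \<times> ?J. A i k * A j l * ?D) = ?D"
    using A1[OF i] A1[OF j]
    by (simp add: sum.cartesian_product[symmetric] sum_distrib_right[symmetric] sum_distrib_left[symmetric])
  also have "?D - A i m * A j m * ?D \<le> ?D - d * d * ?D"
    using d i j A0 m disagreement_nonneg[OF N, of u]
    by (intro diff_left_mono mult_right_mono mult_mono) (auto intro: order_trans)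
  finally show "norm ((\<Sum>k\<in>?J. A i k *\<^sub>R u k) - (\<Sum>k\<in>?J. A j k *\<^sub>R u k)) \<le> (1 - d\<^sup>2) * ?D"
    by (simp add: algebra_simps power2_eq_square)
qed

section \<open>Positivity and contraction of powers of the weight matrix\<close>

context network
begin

definition mix :: "(nat \<Rightarrow> 'a::real_vector) \<Rightarrow> nat \<Rightarrow> 'a" where
  "mix u i = (\<Sum>j=1..N. W i j *\<^sub>R u j)"

fun W_pow :: "nat \<Rightarrow> nat \<Rightarrow> nat \<Rightarrow> real" where
  "W_pow 0 i j = (if i = j then 1 else 0)"
| "W_pow (Suc n) i j = (\<Sum>k=1..N. W i k * W_pow n k j)"

lemma mix_cong: "(\<And>j. j \<in> {1..N} \<Longrightarrow> u j = v j) \<Longrightarrow> mix u i = mix v i"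
  unfolding mix_def by (intro sum.cong) auto

lemma mix_power_cong:
  "(\<And>j. j \<in> {1..N} \<Longrightarrow> u j = v j) \<Longrightarrow> i \<in> {1..N} \<Longrightarrow> (mix ^^ n) u i = (mix ^^ n) v i"
  by (induction n arbitrary: i) (auto intro: mix_cong)

lemma mix_power_add: "(mix ^^ n) (\<lambda>i. u i + v i) = (\<lambda>i. (mix ^^ n) u i + (mix ^^ n) v i)"
  by (induction n) (simp_all add: fun_eq_iff mix_def scaleR_add_right sum.distrib)

lemma mix_power_eq:
  "i \<in> {1..N} \<Longrightarrow> (mix ^^ n) u i = (\<Sum>j=1..N. W_pow n i j *\<^sub>R u j)"
proof (induction n arbitrary: i)
  case 0
  have "(\<Sum>j=1..N. W_pow 0 i j *\<^sub>R u j) = (\<Sum>j=1..N. if i = j then u j else 0)"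
    by (intro sum.cong) auto
  then show ?case using 0 by simp
next
  case (Suc n)
  have "(mix ^^ Suc n) u i = (\<Sum>k=1..N. W i k *\<^sub>R (\<Sum>j=1..N. W_pow n k j *\<^sub>R u j))"
    using Suc.IH by (simp add: mix_def[of "(mix ^^ n) u"])
  also have "\<dots> = (\<Sum>j=1..N. W_pow (Suc n) i j *\<^sub>R u j)"
    by (simp add: scaleR_sum_right scaleR_sum_left) (rule sum.swap)
  finally show ?case .
qed

lemma W_pow_nonneg: "i \<in> {1..N} \<Longrightarrow> j \<in> {1..N} \<Longrightarrow> W_pow n i j \<ge> 0"
  by (induction n arbitrary: i) (auto intro!: sum_nonneg mult_nonneg_nonneg W_nonneg)

lemma W_pow_rows: "i \<in> {1..N} \<Longrightarrow> (\<Sum>j=1..N. W_pow n i j) = 1"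
proof (induction n arbitrary: i)
  case (Suc n)
  have "(\<Sum>j=1..N. W_pow (Suc n) i j) = (\<Sum>k=1..N. W i k * (\<Sum>j=1..N. W_pow n k j))"
    by (simp add: sum_distrib_left) (rule sum.swap)
  then show ?case using Suc W_rows by simp
qed simp

lemma W_pow_Suc_ge:
  "i \<in> {1..N} \<Longrightarrow> k \<in> {1..N} \<Longrightarrow> j \<in> {1..N} \<Longrightarrow> W i k * W_pow n k j \<le> W_pow (Suc n) i j"
  unfolding W_pow.simps
  by (rule member_le_sum[where f = "\<lambda>k. W i k * W_pow n k j"]) (auto intro!: mult_nonneg_nonneg W_nonneg W_pow_nonneg)

lemma W_diag_pos: "i \<in> {1..N} \<Longrightarrow> W i i > 0"
  using W_lower by force

text \<open>A walk may wait at its end vertex, because the diagonal of \<open>W\<close> is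
  positive.\<close>

lemma W_pow_pos_add:
  assumes "i \<in> {1..N}" "j \<in> {1..N}" "W_pow n i j > 0"
  shows "W_pow (m + n) i j > 0"
proof (induction m)
  case (Suc m)
  then have "0 < W i i * W_pow (m + n) i j" using W_diag_pos assms by simp
  then show ?case using W_pow_Suc_ge[of i i j "m + n"] assms by simp
qed (use assms in simp)

text \<open>An edge \<open>(k, i)\<close> means that \<open>i\<close> receives from \<open>k\<close>
  with weight \<open>W i k > 0\<close>, so a path from \<open>j\<close> to \<open>i\<close> shows up
  in the entry \<open>(i, j)\<close>. Appending an edge to the path multiplies by \<open>W\<close>
  on the left; a loop is covered by the positive diagonal.\<close>

lemma W_pow_pos_path:
  assumes "(j, i) \<in> E\<^sup>*" and j: "j \<in> {1..N}"
  shows "i \<in> {1..N} \<and> (\<exists>n. W_pow n i j > 0)"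
  using assms(1)
proof (induction rule: rtrancl_induct)
  case base
  show ?case using j by (auto intro!: exI[of _ 0])
next
  case (step k i)
  then obtain n where k: "k \<in> {1..N}" and n: "W_pow n k j > 0" by auto
  have i: "i \<in> {1..N}" using step edges by auto
  have "W i k > 0" using W_edges[OF i k] W_diag_pos[OF k] step by (cases "i = k") auto
  then have "0 < W i k * W_pow n k j" using n by simp
  then show ?case using W_pow_Suc_ge[OF i k j, of n] i by (auto intro!: exI[of _ "Suc n"])
qed

lemma W_pow_column_pos:
  assumes j: "j \<in> {1..N}"
  shows "\<exists>n d. n \<ge> 1 \<and> d > 0 \<and> (\<forall>i\<in>{1..N}. W_pow n i j \<ge> d)"
proof -
  have "\<forall>i\<in>{1..N}. \<exists>n. W_pow n i j > 0"
    using W_pow_pos_path strongly_connected j by blast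
  then obtain l where l: "\<And>i. i \<in> {1..N} \<Longrightarrow> W_pow (l i) i j > 0" by metis
  \<comment> \<open>Waiting brings the path lengths of all rows to a common exponent; the successor
    makes it at least 1.\<close>
  define n where "n = Suc (Max (l ` {1..N}))"
  have pos: "W_pow n i j > 0" if i: "i \<in> {1..N}" for i
  proof -
    have "l i \<le> n" unfolding n_def using i by (intro le_SucI Max_ge) auto
    then show ?thesis using W_pow_pos_add[OF i j l[OF i], of "n - l i"] by simp
  qed
  let ?d = "Min ((\<lambda>i. W_pow n i j) ` {1..N})"
  have "?d > 0" using N_pos pos by (subst Min_gr_iff) auto
  moreover have "\<forall>i\<in>{1..N}. ?d \<le> W_pow n i j" by (intro ballI Min_le) auto
  ultimately show ?thesis by (intro exI[of _ n] exI[of _ ?d]) (auto simp: n_def)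
qed

lemma disagreement_mix_power_le:
  fixes u :: "nat \<Rightarrow> 'a::real_normed_vector"
  assumes "j \<in> {1..N}" "0 \<le> d" "\<And>i. i \<in> {1..N} \<Longrightarrow> d \<le> W_pow n i j"
  shows "disagreement N ((mix ^^ n) u) \<le> (1 - d\<^sup>2) * disagreement N u"
proof -
  have "disagreement N ((mix ^^ n) u) = disagreement N (\<lambda>i. \<Sum>j=1..N. W_pow n i j *\<^sub>R u j)"
    by (intro disagreement_cong mix_power_eq)
  also have "\<dots> \<le> (1 - d\<^sup>2) * disagreement N u"
    using assms N_pos W_pow_nonneg W_pow_rows by (intro disagreement_stochastic_le) auto
  finally show ?thesis .
qed

lemma disagreement_mix_power_nonexpansive:
  fixes u :: "nat \<Rightarrow> 'a::real_normed_vector"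
  shows "disagreement N ((mix ^^ n) u) \<le> disagreement N u"
  using disagreement_mix_power_le[of 1 0 n u] N_pos W_pow_nonneg by simp

lemma disagreement_mix_power_contracts:
  "\<exists>n \<delta>. n \<ge> 1 \<and> 0 < \<delta> \<and> \<delta> \<le> 1 \<and>
     (\<forall>u :: nat \<Rightarrow> 'a::real_normed_vector. disagreement N ((mix ^^ n) u) \<le> (1 - \<delta>) * disagreement N u)"
proof -
  have 1: "1 \<in> {1..N}" using N_pos by simp
  obtain n d where n: "n \<ge> 1" and d: "d > 0" "\<And>i. i \<in> {1..N} \<Longrightarrow> d \<le> W_pow n i 1"
    using W_pow_column_pos[OF 1] by auto
  \<comment> \<open>An entry of a nonnegative row with sum 1 is at most 1, which makes
    \<open>d\<^sup>2\<close> an admissible \<open>\<delta>\<close>.\<close>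
  have "W_pow n 1 1 \<le> (\<Sum>j=1..N. W_pow n 1 j)"
    using 1 W_pow_nonneg by (intro member_le_sum) auto
  then have "d \<le> 1" using d(2)[OF 1] W_pow_rows[OF 1, of n] by simp
  then have "d\<^sup>2 \<le> 1" using d(1) by (simp add: power_le_one)
  then show ?thesis
    using disagreement_mix_power_le[OF 1, of d n] d n by (intro exI[of _ n] exI[of _ "d\<^sup>2"]) auto
qed

text \<open>Giving the agents outside \<open>Q\<close> identity rows keeps the rows stochastic, and
  \<open>disagreement_stochastic_le\<close> with \<open>d = 0\<close> asks for nothing about
  columns.\<close>

lemma disagreement_partial_mix:
  fixes u :: "nat \<Rightarrow> 'a::real_normed_vector"
  shows "disagreement N (\<lambda>i. if Q i then mix u i else u i) \<le> disagreement N u"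
proof -
  let ?A = "\<lambda>i j. if Q i then W i j else if i = j then 1 else 0"
  have eq: "(if Q i then mix u i else u i) = (\<Sum>j=1..N. ?A i j *\<^sub>R u j)" if "i \<in> {1..N}" for i
  proof (cases "Q i")
    case False
    have "(\<Sum>j=1..N. ?A i j *\<^sub>R u j) = (\<Sum>j=1..N. if i = j then u j else 0)"
      using False by (intro sum.cong) auto
    then show ?thesis using False that by simp
  qed (simp add: mix_def)
  have "disagreement N (\<lambda>i. if Q i then mix u i else u i) = disagreement N (\<lambda>i. \<Sum>j=1..N. ?A i j *\<^sub>R u j)"
    by (intro disagreement_cong eq)
  also have "\<dots> \<le> (1 - 0\<^sup>2) * disagreement N u"
  proof (rule disagreement_stochastic_le[where m = 1])
    show "(\<Sum>j=1..N. ?A i j) = 1" if "i \<in> {1..N}" for i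
      using W_rows[OF that] that by (cases "Q i") simp_all
  qed (use N_pos W_nonneg in auto)
  finally show ?thesis by simp
qed

end

text \<open>
  A Lyapunov function for the recursion of the expected disagreements \<open>u t k\<close> of \<open>W^k x^t\<close>. The weights
  \<open>(q / \<rho>)^k\<close> make the shift \<open>k \<mapsto> k + 1\<close> contract by \<open>\<rho>\<close>; for \<open>\<rho> = 1\<close> the total weight left over
  for \<open>u t 0\<close> is \<open>1 - q^L \<delta> < 1\<close>, so some \<open>\<rho> < 1\<close> also works.
\<close>

lemma shift_recursion_rate:
  fixes q \<delta> :: real
  assumes q: "0 < q" "q < 1" and \<delta>: "0 < \<delta>"  and L: "L \<ge> 1"
  shows "\<exists>\<rho>. 0 < \<rho> \<and> \<rho> < 1 \<and>
    (1 - q) * (\<Sum>k<L. (q / \<rho>) ^ k) + q * (q / \<rho>) ^ (L - 1) * (1 - \<delta>) \<le> \<rho>"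
proof -
  let ?f = "\<lambda>\<rho>. (1 - q) * (\<Sum>k<L. (q / \<rho>) ^ k) + q * (q / \<rho>) ^ (L - 1) * (1 - \<delta>) - \<rho>"
  have "(?f \<longlongrightarrow> ?f 1) (at_left 1)" by (intro tendsto_intros) simp_all
  moreover have "?f 1 < 0"
  proof -
    have "(1 - q) * (\<Sum>k<L. q ^ k) = 1 - q ^ L" using q by (simp add: sum_gp_strict)
    moreover have "q * q ^ (L - 1) = q ^ L" using L by (simp flip: power_Suc)
    ultimately show ?thesis using q \<delta> by (simp add: algebra_simps)
  qed
  ultimately have "\<forall>\<^sub>F \<rho> in at_left 1. ?f \<rho> < 0" by (rule order_tendstoD(2))
  moreover have "\<forall>\<^sub>F \<rho> in at_left 1. \<rho> \<in> {0<..<1::real}"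
    by (rule eventually_at_leftI[of 0]) auto
  ultimately have "\<forall>\<^sub>F \<rho> in at_left 1. ?f \<rho> < 0 \<and> \<rho> \<in> {0<..<1}" by (rule eventually_conj)
  then obtain \<rho> where "?f \<rho> < 0 \<and> \<rho> \<in> {0<..<1}"
    using eventually_happens trivial_limit_at_left_real by blast
  then show ?thesis by (intro exI[of _ \<rho>]) auto
qed

text \<open>As \<open>q\<close> times the weight of \<open>k\<close> is \<rho> times the weight of
  \<open>k + 1\<close>, the shifted terms reproduce \<rho> times the old weighted sum without its
  term for \<open>k = 0\<close>. The term with \<open>u L\<close> falls back to \<open>u 0\<close>
  by contraction, and \<open>rate\<close> says that the coefficient then collected at
  \<open>u 0\<close> is not positive.\<close>

lemma shift_recursion_step:
  fixes u v :: "nat \<Rightarrow> real"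
  assumes q: "0 < q" and \<rho>: "0 < \<rho>"
    and rate: "(1 - q) * (\<Sum>k<L. (q / \<rho>) ^ k) + q * (q / \<rho>) ^ (L - 1) * (1 - \<delta>) \<le> \<rho>"
    and L: "L \<ge> 1" and u0: "u 0 \<ge> 0"
    and step: "\<And>k. k < L \<Longrightarrow> v k \<le> q * u (Suc k) + (1 - q) * u 0 + c"
    and last: "u L \<le> (1 - \<delta>) * u 0"
  shows "(\<Sum>k<L. (q / \<rho>) ^ k * v k)
    \<le> \<rho> * (\<Sum>k<L. (q / \<rho>) ^ k * u k) + (\<Sum>k<L. (q / \<rho>) ^ k) * c"
proof -
  let ?w = "\<lambda>k. (q / \<rho>) ^ k"
  obtain l where l: "L = Suc l" using L by (cases L) auto
  have w: "?w k \<ge> 0" for k using q \<rho> by simp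
  have qw: "q * ?w k = \<rho> * ?w (Suc k)" for k using \<rho> by simp
  have "(\<Sum>k<L. ?w k * v k) \<le> (\<Sum>k<L. ?w k * (q * u (Suc k) + (1 - q) * u 0 + c))"
    using step w by (intro sum_mono mult_left_mono) auto
  also have "\<dots> = (\<Sum>k<L. q * ?w k * u (Suc k)) + (1 - q) * (\<Sum>k<L. ?w k) * u 0 + (\<Sum>k<L. ?w k) * c"
    by (simp add: algebra_simps sum.distrib sum_distrib_left sum_subtractf)
  also have "(\<Sum>k<L. q * ?w k * u (Suc k)) = (\<Sum>k<l. \<rho> * ?w (Suc k) * u (Suc k)) + q * ?w l * u L"
    by (simp only: l sum.lessThan_Suc qw)
  also have "q * ?w l * u L \<le> q * ?w l * ((1 - \<delta>) * u 0)"
    using last q w by (intro mult_left_mono) auto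
  also have "(\<Sum>k<l. \<rho> * ?w (Suc k) * u (Suc k)) = \<rho> * (\<Sum>k<L. ?w k * u k) - \<rho> * u 0"
    using \<rho> unfolding l sum.lessThan_Suc_shift by (simp add: sum_distrib_left algebra_simps)
  finally have "(\<Sum>k<L. ?w k * v k) \<le> \<rho> * (\<Sum>k<L. ?w k * u k) + (\<Sum>k<L. ?w k) * c
      + ((1 - q) * (\<Sum>k<L. ?w k) + q * ?w (L - 1) * (1 - \<delta>) - \<rho>) * u 0"
    by (simp add: l algebra_simps)
  moreover have "((1 - q) * (\<Sum>k<L. ?w k) + q * ?w (L - 1) * (1 - \<delta>) - \<rho>) * u 0 \<le> 0"
    using rate u0 by (intro mult_nonpos_nonneg) auto
  ultimately show ?thesis by linarith
qed

lemma linear_recursion_bound: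
  fixes V \<epsilon> :: "nat \<Rightarrow> real"
  assumes \<rho>: "0 \<le> \<rho>" and step: "\<And>t. V (Suc t) \<le> \<rho> * V t + \<epsilon> t"
  shows "V t \<le> \<rho> ^ t * V 0 + (\<Sum>s<t. \<rho> ^ (t - s - 1) * \<epsilon> s)"
proof (induction t)
  case (Suc t)
  have "\<rho> * (\<Sum>s<t. \<rho> ^ (t - s - 1) * \<epsilon> s) = (\<Sum>s<t. \<rho> ^ (Suc t - s - 1) * \<epsilon> s)"
    unfolding sum_distrib_left
  proof (intro sum.cong refl)
    fix s assume "s \<in> {..<t}"
    \<comment> \<open>Subtraction of naturals is truncated; \<open>s < t\<close> makes the exponents
      differ by exactly one.\<close>
    then have "Suc t - s - 1 = Suc (t - s - 1)" by auto
    then show "\<rho> * (\<rho> ^ (t - s - 1) * \<epsilon> s) = \<rho> ^ (Suc t - s - 1) * \<epsilon> s" by simp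
  qed
  moreover have "\<rho> * V t \<le> \<rho> * (\<rho> ^ t * V 0 + (\<Sum>s<t. \<rho> ^ (t - s - 1) * \<epsilon> s))"
    using Suc \<rho> by (rule mult_left_mono)
  ultimately show ?case using step[of t] by (simp add: algebra_simps)
qed simp

section \<open>Independence from the past\<close>

lemma block_linear: "linear (block blk l)"
  by (rule linearI) (simp_all add: block_def vec_eq_iff)

lemmas block_sum = linear_sum[OF block_linear]
  and block_scale = linear_scale[OF block_linear]

lemma borel_measurable_block: "block blk l \<in> borel_measurable borel"
  by (intro borel_measurable_continuous_onI linear_continuous_on linear_linear[THEN iffD2] block_linear
      linear_conv_bounded_linear[THEN iffD1])

lemma norm_block_le: "norm (block blk l u) \<le> norm u"
  unfolding block_def by (intro norm_le_componentwise_cart) simp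

lemma sum_block:
  assumes "\<And>k. blk k \<in> {1..B}"
  shows "(\<Sum>l=1..B. block blk l u) = u"
  using assms by (simp add: vec_eq_iff block_def)

lemma measurable_vimage_algebra_subset:
  assumes f: "f \<in> space F \<rightarrow> space M"
    and sub: "sets (vimage_algebra (space F) f M) \<subseteq> sets F"
  shows "f \<in> measurable F M"
proof (rule measurableI)
  fix A assume "A \<in> sets M"
  then have "f -` A \<inter> space F \<in> sets (vimage_algebra (space F) f M)" by (rule in_vimage_algebra)
  then show "f -` A \<inter> space F \<in> sets F" using sub by blast
qed (use f in auto)

text \<open>
  The library relation \<open>indep_var\<close> only relates random variables with values in the same type, hence
  the direct product argument.
\<close>

lemma (in prob_space) distr_Pair_indep:
  assumes ind: "indep_set (sets F) (sets G)" and sp: "space F = space M" "space G = space M"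
    and X: "X \<in> measurable F S" and Y: "Y \<in> measurable G T"
  shows "distr M (S \<Otimes>\<^sub>M T) (\<lambda>e. (X e, Y e)) = distr M S X \<Otimes>\<^sub>M distr M T Y"
proof -
  have "subalgebra M F" "subalgebra M G"
    using indep_setD_ev1[OF ind] indep_setD_ev2[OF ind] sp by (auto simp: subalgebra_def)
  then have [measurable]: "random_variable S X" "random_variable T Y"
    using X Y by (auto intro: measurable_from_subalg)
  interpret X: prob_space "distr M S X" by (rule prob_space_distr) simp
  interpret Y: prob_space "distr M T Y" by (rule prob_space_distr) simp
  show ?thesis
  proof (rule pair_measure_eqI[symmetric])
    fix A B assume A: "A \<in> sets (distr M S X)" and B: "B \<in> sets (distr M T Y)"
    have "X -` A \<inter> space M \<in> sets F" "Y -` B \<inter> space M \<in> sets G"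
      using measurable_sets[OF X] measurable_sets[OF Y] A B sp by auto
    then have "prob ((X -` A \<inter> space M) \<inter> (Y -` B \<inter> space M))
        = prob (X -` A \<inter> space M) * prob (Y -` B \<inter> space M)"
      by (rule indep_setD[OF ind])
    moreover have "(\<lambda>e. (X e, Y e)) -` (A \<times> B) \<inter> space M
        = (X -` A \<inter> space M) \<inter> (Y -` B \<inter> space M)" by auto
    ultimately show "emeasure (distr M S X) A * emeasure (distr M T Y) B
        = emeasure (distr M (S \<Otimes>\<^sub>M T) (\<lambda>e. (X e, Y e))) (A \<times> B)"
      using A B by (simp add: emeasure_distr emeasure_eq_measure ennreal_mult)
  qed (auto intro: X.sigma_finite_measure_axioms Y.sigma_finite_measure_axioms)
qed

text \<open>The indicator of \<open>A\<close> and \<open>Z\<close> are independent real variables,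
  so the expectation of their product factors. It serves to separate the draws at time
  \<open>t\<close> from the state reached before them.\<close>

lemma (in prob_space) integral_indicator_mult_indep:
  fixes Z :: "'a \<Rightarrow> real"
  assumes ind: "indep_set (sets F) (sets G)" and sp: "space F = space M" "space G = space M"
    and A: "A \<in> sets F" and Z: "Z \<in> borel_measurable G" "integrable M Z"
  shows "(\<integral>e. indicator A e * Z e \<partial>M) = prob A * (\<integral>e. Z e \<partial>M)"
proof -
  have "(indicator A :: 'a \<Rightarrow> real) \<in> borel_measurable F" using A by simp
  note pair = distr_Pair_indep[OF ind sp this Z(1)]
  have ev: "A \<in> events" using indep_setD_ev1[OF ind] A by auto
  then have "indep_var borel (indicator A :: 'a \<Rightarrow> real) borel Z"
    unfolding indep_var_distribution_eq using Z pair by auto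
  then show ?thesis
    using Z ev indep_var_lebesgue_integral[of "indicator A" Z] by (simp add: emeasure_eq_measure)
qed

text \<open>Under the product law \<open>X\<close> can be frozen at a value \<open>u\<close>, and
  the bounds \<open>c\<close> are then averaged over a probability law. With the nonnegative
  integral this also yields integrability of a composition about which nothing is known
  beforehand.\<close>

lemma (in prob_space) nn_integral_indep_le:
  assumes ind: "indep_set (sets F) (sets G)" and sp: "space F = space M" "space G = space M"
    and X: "X \<in> measurable F S" and Y: "Y \<in> measurable G T"
    and f: "f \<in> borel_measurable (S \<Otimes>\<^sub>M T)"
    and le: "\<And>u. u \<in> space S \<Longrightarrow> (\<integral>\<^sup>+z. f (u, z) \<partial>distr M T Y) \<le> c"
  shows "(\<integral>\<^sup>+e. f (X e, Y e) \<partial>M) \<le> c"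
proof -
  have "subalgebra M F" "subalgebra M G"
    using indep_setD_ev1[OF ind] indep_setD_ev2[OF ind] sp by (auto simp: subalgebra_def)
  then have [measurable]: "random_variable S X" "random_variable T Y"
    using X Y by (auto intro: measurable_from_subalg)
  interpret X: prob_space "distr M S X" by (rule prob_space_distr) simp
  interpret Y: prob_space "distr M T Y" by (rule prob_space_distr) simp
  have "(\<integral>\<^sup>+e. f (X e, Y e) \<partial>M) = (\<integral>\<^sup>+v. f v \<partial>distr M (S \<Otimes>\<^sub>M T) (\<lambda>e. (X e, Y e)))"
    using f by (subst nn_integral_distr) auto
  also have "\<dots> = (\<integral>\<^sup>+v. f v \<partial>(distr M S X \<Otimes>\<^sub>M distr M T Y))"
    by (simp add: distr_Pair_indep[OF ind sp X Y])
  also have "\<dots> = (\<integral>\<^sup>+u. \<integral>\<^sup>+z. f (u, z) \<partial>distr M T Y \<partial>distr M S X)"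
    using f by (intro Y.nn_integral_fst[symmetric]) (simp cong: measurable_cong_sets)
  also have "\<dots> \<le> (\<integral>\<^sup>+u. c \<partial>distr M S X)"
    using le by (intro nn_integral_mono) simp
  also have "\<dots> = c" using X.emeasure_space_1 by simp
  finally show ?thesis .
qed

section \<open>Expected disagreement of the iterates\<close>

context distributed_block_proximal
begin

abbreviation X :: "(real ^ 'n) set" where
  "X \<equiv> block_product blk B Xs"

text \<open>\<open>current t\<close> and \<open>past t\<close> turn the two families in
  \<open>draws_indep_past\<close> into measures, so that functions can be measurable with respect to
  them; only their spaces and sets matter. The family \<open>past t\<close> contains the draws up to
  time \<open>t - 1\<close> and is the filtration to which the iterates are adapted.\<close>

definition current :: "nat \<Rightarrow> 'e measure" where
  "current t = sigma (space P) (\<Union>d\<in>UNIV \<times> {1..N}. draw_events P D s ell \<xi> t d)"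

definition past :: "nat \<Rightarrow> 'e measure" where
  "past t = sigma (space P)
     ((\<Union>i\<in>{1..N}. sets (vimage_algebra (space P) (x i 0) borel)) \<union>
      (\<Union>\<tau>\<in>{..<t}. \<Union>d\<in>UNIV \<times> {1..N}. draw_events P D s ell \<xi> \<tau> d))"

lemma draw_events_Pow: "draw_events P D s ell \<xi> t d \<subseteq> Pow (space P)"
proof (cases d)
  case (Pair a i)
  then show ?thesis
    using sets.space_closed[of "vimage_algebra (space P) (s i t) (count_space UNIV)"]
      sets.space_closed[of "vimage_algebra (space P) (ell i t) (count_space UNIV)"]
      sets.space_closed[of "vimage_algebra (space P) (\<xi> i t) (D i)"]
    by (cases a) simp_all
qed

lemma generators_Pow:
  "(\<Union>d\<in>I. draw_events P D s ell \<xi> t d) \<subseteq> Pow (space P)"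
  "(\<Union>i\<in>{1..N}. sets (vimage_algebra (space P) (x i 0) borel)) \<union>
      (\<Union>\<tau>\<in>{..<t}. \<Union>d\<in>UNIV \<times> {1..N}. draw_events P D s ell \<xi> \<tau> d) \<subseteq> Pow (space P)"
proof -
  show "(\<Union>d\<in>I. draw_events P D s ell \<xi> t d) \<subseteq> Pow (space P)"
    using draw_events_Pow by blast
  have "sets (vimage_algebra (space P) (x i 0) borel) \<subseteq> Pow (space P)" for i
    using sets.space_closed[of "vimage_algebra (space P) (x i 0) borel"] by simp
  then show "(\<Union>i\<in>{1..N}. sets (vimage_algebra (space P) (x i 0) borel)) \<union>
      (\<Union>\<tau>\<in>{..<t}. \<Union>d\<in>UNIV \<times> {1..N}. draw_events P D s ell \<xi> \<tau> d) \<subseteq> Pow (space P)"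
    using draw_events_Pow by blast
qed

lemma space_past [simp]: "space (past t) = space P"
  and space_current [simp]: "space (current t) = space P"
  unfolding past_def current_def by (simp_all only: space_measure_of[OF generators_Pow(1)] space_measure_of[OF generators_Pow(2)])

lemma current_indep_past: "indep_set (sets (current t)) (sets (past t))"
  using draws_indep_past[of t] unfolding past_def current_def
  by (simp only: sets_measure_of[OF generators_Pow(1)] sets_measure_of[OF generators_Pow(2)])

lemma past_subalgebra: "subalgebra P (past t)"
  using indep_setD_ev2[OF current_indep_past] by (auto simp: subalgebra_def)

lemma measurable_current: "f \<in> measurable (current t) M \<Longrightarrow> f \<in> measurable (past (Suc t)) M"
  unfolding current_def past_def
  by (rule subsetD[OF measurable_mono1[OF generators_Pow(2)]]) auto

lemma measurable_past_Suc: "f \<in> measurable (past t) M \<Longrightarrow> f \<in> measurable (past (Suc t)) M"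
  unfolding past_def by (rule subsetD[OF measurable_mono1[OF generators_Pow(2)]]) auto

lemma x_0_measurable_past:
  assumes "i \<in> {1..N}"
  shows "x i 0 \<in> borel_measurable (past 0)"
proof (rule measurable_vimage_algebra_subset)
  show "sets (vimage_algebra (space (past 0)) (x i 0) borel) \<subseteq> sets (past 0)"
    using assms unfolding space_past unfolding past_def sets_measure_of[OF generators_Pow(2)]
    by (intro subsetI sigma_sets.Basic) blast
qed simp

lemma draw_events_current:
  "i \<in> {1..N} \<Longrightarrow> draw_events P D s ell \<xi> t (k, i) \<subseteq> sets (current t)"
  unfolding current_def sets_measure_of[OF generators_Pow(1)]
  by (intro subsetI sigma_sets.Basic) blast

lemma draws_measurable_current:
  assumes i: "i \<in> {1..N}"
  shows "s i t \<in> measurable (current t) (count_space UNIV)"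
    and "ell i t \<in> measurable (current t) (count_space UNIV)"
    and "\<xi> i t \<in> measurable (current t) (D i)"
proof -
  show "s i t \<in> measurable (current t) (count_space UNIV)"
    using draw_events_current[OF i, of t Awake] by (intro measurable_vimage_algebra_subset) simp_all
  show "ell i t \<in> measurable (current t) (count_space UNIV)"
    using draw_events_current[OF i, of t Block] by (intro measurable_vimage_algebra_subset) simp_all
  show "\<xi> i t \<in> measurable (current t) (D i)"
    using draw_events_current[OF i, of t Sample] measurable_space[OF \<xi>_measurable[OF i, of t]]
    by (intro measurable_vimage_algebra_subset) auto
qed

text \<open>The coordinate type is nonempty, so some coordinate has a block number in
  \<open>{1..B}\<close>.\<close>

lemma B_pos: "B \<ge> 1"
  using blk[of undefined] by simp

definition \<sigma>_low :: real where
  "\<sigma>_low = Min (\<sigma> ` {1..B})"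

lemma \<sigma>_low_le: "l \<in> {1..B} \<Longrightarrow> \<sigma>_low \<le> \<sigma> l"
  unfolding \<sigma>_low_def by (intro Min_le) auto

lemma \<sigma>_low_pos: "\<sigma>_low > 0"
  unfolding \<sigma>_low_def using B_pos \<sigma>_pos by (subst Min_gr_iff) auto

section \<open>Feasibility and adaptedness of the iterates\<close>

lemmas prox_facts = \<omega>_strongly_convex \<sigma>_pos \<omega>_C1 Xs_closed

lemma block_y:
  "i \<in> {1..N} \<Longrightarrow> e \<in> space P \<Longrightarrow> block blk l (y i t e) = mix (\<lambda>j. block blk l (x j t e)) i"
  by (simp add: y_def mix_def block_sum block_scale)

definition activated :: "nat \<Rightarrow> nat \<Rightarrow> nat \<Rightarrow> 'e \<Rightarrow> bool" where
  "activated l i t e \<longleftrightarrow> s i t e = 1 \<and> ell i t e = l"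

lemma block_x_Suc:
  assumes "i \<in> {1..N}" "e \<in> space P" "l \<in> {1..B}"
  shows "block blk l (x i (Suc t) e) =
    (if activated l i t e
     then prox (Xs l) (\<omega> l) (d\<omega> l) (block blk l (y i t e))
       (block blk l (g i (y i t e) (\<xi> i t e))) (\<alpha> i t)
     else block blk l (x i t e))"
  using x_awake[OF assms, of t] x_idle[OF assms(1,2), of t] s_range[OF assms(1,2), of t]
  by (auto simp: activated_def)

lemma y_feasible_of_x:
  assumes x: "\<And>j. j \<in> {1..N} \<Longrightarrow> x j t e \<in> X" and i: "i \<in> {1..N}" and e: "e \<in> space P"
  shows "y i t e \<in> X"
  unfolding block_product_def
proof (clarify)
  fix l assume l: "l \<in> {1..B}"
  have "block blk l (x j t e) \<in> Xs l" if "j \<in> {1..N}" for j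
    using x[OF that] l by (auto simp: block_product_def)
  then show "block blk l (y i t e) \<in> Xs l"
    unfolding block_y[OF i e] mix_def
    using i W_nonneg W_rows Xs_convex[OF l] by (intro convex_sum) auto
qed

lemma x_feasible: "i \<in> {1..N} \<Longrightarrow> e \<in> space P \<Longrightarrow> x i t e \<in> X"
proof (induction t arbitrary: i)
  case (Suc t)
  then have y: "y i t e \<in> X" by (intro y_feasible_of_x) auto
  have "block blk l (x i (Suc t) e) \<in> Xs l" if l: "l \<in> {1..B}" for l
  proof -
    have "block blk l (x i t e) \<in> Xs l" "block blk l (y i t e) \<in> Xs l"
      using Suc y l by (auto simp: block_product_def)
    moreover from this have "Xs l \<noteq> {}" by auto
    ultimately show ?thesis
      using prox_mem[OF prox_facts(1-4)[OF l] stepsize_pos[OF Suc.prems(1)]]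
      by (simp add: block_x_Suc[OF Suc.prems l])
  qed
  then show ?case by (simp add: block_product_def)
qed (simp add: init_feasible)

lemma y_feasible: "i \<in> {1..N} \<Longrightarrow> e \<in> space P \<Longrightarrow> y i t e \<in> X"
  by (intro y_feasible_of_x x_feasible)

lemma y_measurable_of_x:
  assumes x: "\<And>j. j \<in> {1..N} \<Longrightarrow> x j t \<in> borel_measurable M" and sp: "space M = space P"
    and i: "i \<in> {1..N}"
  shows "y i t \<in> measurable M (restrict_space borel X)"
proof (rule measurable_restrict_space2)
  have "(\<lambda>e. \<Sum>j=1..N. W i j *\<^sub>R x j t e) \<in> borel_measurable M"
    using x by (intro borel_measurable_sum borel_measurable_scaleR) auto
  then show "y i t \<in> borel_measurable M"
    using y_def[OF i, of _ t] sp by (subst measurable_cong) auto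
qed (use y_feasible[OF i] sp in auto)

lemma subgradient_measurable:
  assumes i: "i \<in> {1..N}" and y: "y i t \<in> measurable M (restrict_space borel X)"
    and \<xi>: "\<xi> i t \<in> measurable M (D i)"
  shows "(\<lambda>e. g i (y i t e) (\<xi> i t e)) \<in> borel_measurable M"
  using measurable_compose[OF measurable_Pair[OF y \<xi>] g_measurable[OF i]] by simp

text \<open>The new iterate is a blockwise function of the old one and of the draws at time
  \<open>t\<close>, and both \<open>past t\<close> and \<open>current t\<close> are contained in
  \<open>past (Suc t)\<close>.\<close>

lemma x_measurable_past: "i \<in> {1..N} \<Longrightarrow> x i t \<in> borel_measurable (past t)"
proof (induction t arbitrary: i)
  case 0
  then show ?case by (rule x_0_measurable_past)
next
  case (Suc t)
  note i = \<open>i \<in> {1..N}\<close>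
  let ?M = "past (Suc t)"
  have x: "x j t \<in> borel_measurable ?M" if "j \<in> {1..N}" for j
    using Suc.IH[OF that] by (rule measurable_past_Suc)
  note [measurable] = draws_measurable_current[OF i, of t, THEN measurable_current] borel_measurable_block
  \<comment> \<open>The target is the restricted space because \<open>g i\<close> is jointly
    measurable only over \<open>X\<close>.\<close>
  have y: "y i t \<in> measurable ?M (restrict_space borel X)"
    using x i by (intro y_measurable_of_x) auto
  have [measurable]: "x i t \<in> borel_measurable ?M" using x i by blast
  have [measurable]: "y i t \<in> borel_measurable ?M"
    using y by (rule measurable_restrict_space2_iff[THEN iffD1, THEN conjunct1])
  have [measurable]: "(\<lambda>e. g i (y i t e) (\<xi> i t e)) \<in> borel_measurable ?M"
    by (rule subgradient_measurable[OF i y]) measurable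
  have "(\<lambda>e. block blk l (x i (Suc t) e)) \<in> borel_measurable ?M" if l: "l \<in> {1..B}" for l
  proof -
    have [measurable]: "(\<lambda>e. prox (Xs l) (\<omega> l) (d\<omega> l) (block blk l (y i t e))
       (block blk l (g i (y i t e) (\<xi> i t e))) (\<alpha> i t)) \<in> borel_measurable ?M"
      using y_feasible[OF i, of _ t] l
      by (intro borel_measurable_prox[OF prox_facts(1-4)[OF l] stepsize_pos[OF i]])
        (auto simp: block_product_def)
    have "(\<lambda>e. if activated l i t e
        then prox (Xs l) (\<omega> l) (d\<omega> l) (block blk l (y i t e))
         (block blk l (g i (y i t e) (\<xi> i t e))) (\<alpha> i t)
        else block blk l (x i t e)) \<in> borel_measurable ?M"
      unfolding activated_def by measurable
    then show ?thesis
      using block_x_Suc[OF i _ l, of _ t] by (subst measurable_cong) auto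
  qed
  \<comment> \<open>A vector is the sum of its blocks, so measurability of each block is
    enough.\<close>
  then have "(\<lambda>e. \<Sum>l=1..B. block blk l (x i (Suc t) e)) \<in> borel_measurable ?M"
    by (intro borel_measurable_sum) auto
  then show ?case unfolding sum_block[OF blk] .
qed

lemma x_measurable: "i \<in> {1..N} \<Longrightarrow> x i t \<in> borel_measurable P"
  using measurable_from_subalg[OF past_subalgebra x_measurable_past] .

lemma past_indep_current: "indep_set (sets (past t)) (sets (current t))"
  using current_indep_past[of t] by (simp add: indep_sets2_eq) (metis Int_commute mult.commute)

section \<open>One iteration as an exact mixing step plus an error, and the chance of full
  activation\<close>

definition error :: "nat \<Rightarrow> nat \<Rightarrow> 'e \<Rightarrow> real" where
  "error i t e = \<alpha> i t / \<sigma>_low * norm (g i (y i t e) (\<xi> i t e))"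

lemma error_nonneg: "i \<in> {1..N} \<Longrightarrow> error i t e \<ge> 0"
  using stepsize_pos[of i t] \<sigma>_low_pos by (simp add: error_def)

text \<open>The next block if all subgradients were zero: pure consensus among the agents that
  update block \<open>l\<close>.\<close>

definition mixed :: "nat \<Rightarrow> nat \<Rightarrow> 'e \<Rightarrow> nat \<Rightarrow> real ^ 'n" where
  "mixed l t e i = (if activated l i t e then mix (\<lambda>j. block blk l (x j t e)) i
     else block blk l (x i t e))"

text \<open>The proximal step starts from the block of \<open>y\<close>, which is the mixed value,
  and \<open>prox_dist_le\<close> bounds its length. Passing to the whole subgradient and to
  \<open>\<sigma>_low\<close> gives one error for all blocks.\<close>

lemma block_x_Suc_near_mixed:
  assumes i: "i \<in> {1..N}" and e: "e \<in> space P" and l: "l \<in> {1..B}"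
  shows "norm (block blk l (x i (Suc t) e) - mixed l t e i) \<le> error i t e"
proof (cases "activated l i t e")
  case True
  let ?g = "g i (y i t e) (\<xi> i t e)"
  have "block blk l (y i t e) \<in> Xs l" using y_feasible[OF i e, of t] l by (auto simp: block_product_def)
  then have "norm (block blk l (x i (Suc t) e) - mixed l t e i) \<le> \<alpha> i t * norm (block blk l ?g) / \<sigma> l"
    using prox_dist_le[OF prox_facts(1-4)[OF l] stepsize_pos[OF i]] True
    by (simp add: block_x_Suc[OF i e l] mixed_def block_y[OF i e])
  also have "\<dots> \<le> \<alpha> i t * norm ?g / \<sigma>_low"
    using stepsize_pos[OF i, of t] \<sigma>_low_pos \<sigma>_low_le[OF l]
    by (intro frac_le mult_left_mono norm_block_le) auto
  finally show ?thesis by (simp add: error_def)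
next
  case False
  then show ?thesis
    using error_nonneg[OF i] by (simp add: block_x_Suc[OF i e l] mixed_def)
qed

definition all_activated :: "nat \<Rightarrow> nat \<Rightarrow> 'e set" where
  "all_activated l t = {e \<in> space P. \<forall>i\<in>{1..N}. activated l i t e}"

lemma all_activated_current: "all_activated l t \<in> sets (current t)"
proof -
  have [measurable]: "Measurable.pred (current t) (activated l i t)" if "i \<in> {1..N}" for i
    using draws_measurable_current(1,2)[OF that, of t] unfolding activated_def by measurable
  have "{e \<in> space (current t). \<forall>i\<in>{1..N}. activated l i t e} \<in> sets (current t)"
    by measurable
  then show ?thesis by (simp add: all_activated_def)
qed

lemma all_activated_event: "all_activated l t \<in> events"
  using indep_setD_ev1[OF current_indep_past] all_activated_current by auto

text \<open>The draws of all agents at one time are independent, so the probability is the product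
  of the numbers \<open>p_on i\<close> and \<open>p i l\<close>, which is positive and does not
  depend on \<open>t\<close>.\<close>

lemma prob_all_activated_ge:
  "\<exists>q>0. q < 1 \<and> (\<forall>l\<in>{1..B}. \<forall>t. q \<le> prob (all_activated l t))"
proof -
  define J where "J = {Awake, Block} \<times> {1..N}"
  define pr where "pr l d = (if fst d = Awake then p_on (snd d) else p (snd d) l)" for l and d :: "draw \<times> nat"
  \<comment> \<open>The entry 1/2 keeps \<open>q\<close> below 1 even when full activation is
    certain.\<close>
  define q where "q = Min (insert (1/2) ((\<lambda>l. prod (pr l) J) ` {1..B}))"
  have "prob (all_activated l t) = prod (pr l) J" if l: "l \<in> {1..B}" for l t
  proof -
    define A where "A d = (if fst d = Awake then s (snd d) t -` {1} \<inter> space P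
      else ell (snd d) t -` {l} \<inter> space P)" for d :: "draw \<times> nat"
    have "A d \<in> draw_events P D s ell \<xi> t d" if "d \<in> J" for d
      using that by (auto simp: J_def A_def intro!: in_vimage_algebra)
    moreover have "J \<noteq> {}" "finite J" "J \<subseteq> UNIV \<times> {1..N}" using N_pos by (auto simp: J_def)
    ultimately have "prob (\<Inter>d\<in>J. A d) = (\<Prod>d\<in>J. prob (A d))"
      by (intro indep_setsD[OF draws_indep[of t]]) auto
    also have "(\<Inter>d\<in>J. A d) = all_activated l t"
    proof (rule set_eqI)
      fix e
      have "1 \<in> {1..N}" using N_pos by simp
      have "e \<in> (\<Inter>d\<in>J. A d) \<longleftrightarrow> (\<forall>i\<in>{1..N}. e \<in> A (Awake, i) \<and> e \<in> A (Block, i))"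
        unfolding J_def by blast
      also have "\<dots> \<longleftrightarrow> (\<forall>i\<in>{1..N}. e \<in> space P \<and> activated l i t e)"
        unfolding activated_def A_def by (intro ball_cong refl) auto
      also have "\<dots> \<longleftrightarrow> e \<in> all_activated l t"
        using \<open>1 \<in> {1..N}\<close> unfolding all_activated_def by blast
      finally show "e \<in> (\<Inter>d\<in>J. A d) \<longleftrightarrow> e \<in> all_activated l t" .
    qed
    also have "(\<Prod>d\<in>J. prob (A d)) = prod (pr l) J"
    proof (intro prod.cong refl)
      fix d assume "d \<in> J"
      then have d: "snd d \<in> {1..N}" by (auto simp: J_def)
      have "s i t -` {1} \<inter> space P = {e \<in> space P. s i t e = 1}"
        "ell i t -` {l} \<inter> space P = {e \<in> space P. ell i t e = l}" for i by auto
      then show "prob (A d) = pr l d"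
        using s_prob[OF d, of t] ell_prob[OF d l, of t] by (simp add: A_def pr_def)
    qed
    finally show ?thesis .
  qed
  moreover have "prod (pr l) J > 0" if "l \<in> {1..B}" for l
    using p_on p_pos that by (intro prod_pos) (auto simp: J_def pr_def)
  then have "q > 0" unfolding q_def by (subst Min_gr_iff) auto
  moreover have "q \<le> 1/2" unfolding q_def by (intro Min_le) auto
  moreover have "q \<le> prod (pr l) J" if "l \<in> {1..B}" for l
    unfolding q_def using that by (intro Min_le) auto
  ultimately show ?thesis by (intro exI[of _ q]) auto
qed

text \<open>The \<open>k\<close> mixing steps are virtual: they supply the quantities
  \<open>u t k\<close> of the Lyapunov function, while \<open>k = 0\<close> is the disagreement of
  the actual iterates.\<close>

definition spread :: "nat \<Rightarrow> nat \<Rightarrow> nat \<Rightarrow> 'e \<Rightarrow> real" where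
  "spread l t k e = disagreement N ((mix ^^ k) (\<lambda>i. block blk l (x i t e)))"

lemma spread_nonneg: "spread l t k e \<ge> 0"
  unfolding spread_def using N_pos by (rule disagreement_nonneg)

lemma spread_le_0: "spread l t k e \<le> spread l t 0 e"
  unfolding spread_def using disagreement_mix_power_nonexpansive by simp

lemma spread_0_le: "spread l t 0 e \<le> 2 * (\<Sum>i=1..N. norm (x i t e))"
proof -
  have "spread l t 0 e \<le> 2 * (\<Sum>i=1..N. norm (block blk l (x i t e)))"
    unfolding spread_def using disagreement_le_sum_norm[OF N_pos] by simp
  also have "\<dots> \<le> 2 * (\<Sum>i=1..N. norm (x i t e))"
    by (intro mult_left_mono sum_mono norm_block_le) simp
  finally show ?thesis .
qed

lemma spread_measurable_past: "spread l t k \<in> borel_measurable (past t)"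
proof -
  have [measurable]: "(\<lambda>e. (mix ^^ k) (\<lambda>i. block blk l (x i t e)) i) \<in> borel_measurable (past t)"
    if "i \<in> {1..N}" for i
    using that
  proof (induction k arbitrary: i)
    case 0
    then show ?case using measurable_compose[OF x_measurable_past borel_measurable_block] by simp
  next
    case (Suc k)
    then show ?case unfolding funpow.simps comp_def mix_def[of "(mix ^^ k) _"]
      by (intro borel_measurable_sum borel_measurable_scaleR) auto
  qed
  have "(\<lambda>e. Max ((\<lambda>ij. norm ((mix ^^ k) (\<lambda>i. block blk l (x i t e)) (fst ij)
      - (mix ^^ k) (\<lambda>i. block blk l (x i t e)) (snd ij))) ` ({1..N} \<times> {1..N}))) \<in> borel_measurable (past t)"
    by (intro borel_measurable_Max) auto
  then show ?thesis by (simp add: spread_def[abs_def] disagreement_def case_prod_beta')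
qed

lemma spread_measurable: "spread l t k \<in> borel_measurable P"
  using measurable_from_subalg[OF past_subalgebra spread_measurable_past] .

text \<open>When all agents update block \<open>l\<close>, the iteration is one more application of
  \<open>mix\<close> and raises \<open>k\<close> by one. Otherwise the virtual steps are discarded
  and partial mixing is nonexpansive, which leaves \<open>k = 0\<close>. The errors split off by
  additivity of \<open>mix ^^ k\<close>.\<close>

lemma spread_Suc_le:
  assumes e: "e \<in> space P" and l: "l \<in> {1..B}"
  shows "spread l (Suc t) k e \<le> indicator (all_activated l t) e * spread l t (Suc k) e
    + (1 - indicator (all_activated l t) e) * spread l t 0 e + 2 * (\<Sum>i=1..N. error i t e)"
proof -
  let ?r = "\<lambda>i. block blk l (x i (Suc t) e) - mixed l t e i"
  have "spread l (Suc t) k e = disagreement N ((mix ^^ k) (\<lambda>i. mixed l t e i + ?r i))"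
    by (simp add: spread_def)
  also have "\<dots> \<le> disagreement N ((mix ^^ k) (mixed l t e)) + disagreement N ((mix ^^ k) ?r)"
    unfolding mix_power_add using N_pos by (rule disagreement_triangle)
  also have "disagreement N ((mix ^^ k) ?r) \<le> disagreement N ?r"
    by (rule disagreement_mix_power_nonexpansive)
  also have "\<dots> \<le> 2 * (\<Sum>i=1..N. norm (?r i))" using N_pos by (rule disagreement_le_sum_norm)
  also have "\<dots> \<le> 2 * (\<Sum>i=1..N. error i t e)"
    by (intro mult_left_mono sum_mono block_x_Suc_near_mixed e l) auto
  finally have 1: "spread l (Suc t) k e \<le> disagreement N ((mix ^^ k) (mixed l t e)) + 2 * (\<Sum>i=1..N. error i t e)"
    by simp
  show ?thesis
  proof (cases "e \<in> all_activated l t")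
    case True
    then have "disagreement N ((mix ^^ k) (mixed l t e))
        = disagreement N ((mix ^^ k) (mix (\<lambda>i. block blk l (x i t e))))"
      by (intro disagreement_cong mix_power_cong) (auto simp: all_activated_def mixed_def)
    also have "\<dots> = spread l t (Suc k) e"
      unfolding spread_def funpow_Suc_right comp_def ..
    finally have "disagreement N ((mix ^^ k) (mixed l t e)) = spread l t (Suc k) e" .
    moreover have "indicator (all_activated l t) e = (1::real)" using True by simp
    ultimately show ?thesis using 1 by simp
  next
    case False
    have "disagreement N ((mix ^^ k) (mixed l t e)) \<le> disagreement N (mixed l t e)"
      by (rule disagreement_mix_power_nonexpansive)
    also have "\<dots> \<le> disagreement N (\<lambda>i. block blk l (x i t e))"
      unfolding mixed_def by (rule disagreement_partial_mix)
    also have "\<dots> = spread l t 0 e" by (simp add: spread_def)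
    finally have "disagreement N ((mix ^^ k) (mixed l t e)) \<le> spread l t 0 e" .
    moreover have "indicator (all_activated l t) e = (0::real)" using False by simp
    ultimately show ?thesis using 1 by simp
  qed
qed

text \<open>The deviation from the mean is the average of the differences to all agents, and each
  difference is the sum of its blocks. The factor \<open>B\<close> of the final bound comes from
  this sum.\<close>

lemma deviation_le_spread:
  assumes i: "i \<in> {1..N}"
  shows "norm (x i t e - (1 / real N) *\<^sub>R (\<Sum>j=1..N. x j t e)) \<le> (\<Sum>l=1..B. spread l t 0 e)"
proof -
  have "norm (x i t e - x j t e) \<le> (\<Sum>l=1..B. spread l t 0 e)" if j: "j \<in> {1..N}" for j
  proof -
    have "norm (x i t e - x j t e) = norm (\<Sum>l=1..B. block blk l (x i t e) - block blk l (x j t e))"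
      unfolding sum_subtractf sum_block[OF blk] ..
    also have "\<dots> \<le> (\<Sum>l=1..B. spread l t 0 e)"
    proof (rule sum_norm_le)
      show "norm (block blk l (x i t e) - block blk l (x j t e)) \<le> spread l t 0 e" for l
        using norm_diff_le_disagreement[OF i j, of "\<lambda>i. block blk l (x i t e)"] by (simp add: spread_def)
    qed
    finally show ?thesis .
  qed
  then have "(\<Sum>j=1..N. norm (x i t e - x j t e)) \<le> real N * (\<Sum>l=1..B. spread l t 0 e)"
    using sum_bounded_above[of "{1..N}" "\<lambda>j. norm (x i t e - x j t e)"] by simp
  then have "norm (\<Sum>j=1..N. x i t e - x j t e) \<le> real N * (\<Sum>l=1..B. spread l t 0 e)"
    by (rule order_trans[OF norm_sum])
  moreover have "x i t e - (1 / real N) *\<^sub>R (\<Sum>j=1..N. x j t e)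
      = (1 / real N) *\<^sub>R (\<Sum>j=1..N. x i t e - x j t e)"
    using N_pos by (simp add: sum_subtractf scaleR_diff_right sum_constant_scaleR del: sum_constant)
  ultimately have "real N * norm (x i t e - (1 / real N) *\<^sub>R (\<Sum>j=1..N. x j t e))
      \<le> real N * (\<Sum>l=1..B. spread l t 0 e)"
    using N_pos by simp
  then show ?thesis using N_pos by (simp only: mult_le_cancel_left_pos of_nat_0_less_iff)
qed

section \<open>Expectations under a first moment bound for the subgradients\<close>

context
  fixes Gi :: "nat \<Rightarrow> real"
  assumes subgradient_moment: "\<And>i u. i \<in> {1..N} \<Longrightarrow> u \<in> X \<Longrightarrow>
    integrable (D i) (\<lambda>z. norm (g i u z)) \<and> (\<integral>z. norm (g i u z) \<partial>D i) \<le> Gi i"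
begin

text \<open>The point \<open>y i t\<close> is determined by the past and the sample by the current
  draws, so the bound for fixed points of \<open>X\<close> carries over to this random
  point.\<close>

lemma norm_subgradient_moment:
  assumes i: "i \<in> {1..N}"
  shows "integrable P (\<lambda>e. norm (g i (y i t e) (\<xi> i t e)))"
    and "(\<integral>e. norm (g i (y i t e) (\<xi> i t e)) \<partial>P) \<le> Gi i"
proof -
  let ?f = "\<lambda>e. norm (g i (y i t e) (\<xi> i t e))"
  have y: "y i t \<in> measurable (past t) (restrict_space borel X)"
    by (rule y_measurable_of_x[OF x_measurable_past space_past i])
  have \<xi>: "\<xi> i t \<in> measurable (current t) (D i)" by (rule draws_measurable_current(3)[OF i])
  have f: "?f \<in> borel_measurable P"
    by (rule measurable_compose[OF subgradient_measurable[OF i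
          measurable_from_subalg[OF past_subalgebra y] \<xi>_measurable[OF i]] borel_measurable_norm])
  have X0: "x i 0 e \<in> X" if "e \<in> space P" for e using x_feasible[OF i that] .
  \<comment> \<open>The sample space is nonempty, hence so is \<open>X\<close>, and the moment bound
    at one point of \<open>X\<close> already forces the sign.\<close>
  have "Gi i \<ge> 0"
  proof -
    obtain e where "e \<in> space P" using not_empty by auto
    then have "(\<integral>z. norm (g i (x i 0 e) z) \<partial>D i) \<le> Gi i" using subgradient_moment[OF i X0] by blast
    then show ?thesis by (rule order_trans[rotated]) simp
  qed
  have "(\<integral>\<^sup>+e. (\<lambda>(u, z). ennreal (norm (g i u z))) (y i t e, \<xi> i t e) \<partial>P) \<le> ennreal (Gi i)"
  proof (rule nn_integral_indep_le[OF past_indep_current space_past space_current y \<xi>])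
    show "(\<lambda>(u, z). ennreal (norm (g i u z))) \<in> borel_measurable (restrict_space borel X \<Otimes>\<^sub>M D i)"
      using g_measurable[OF i] unfolding case_prod_beta' by measurable
    fix u assume "u \<in> space (restrict_space borel X)"
    then have "u \<in> X" by (simp add: space_restrict_space)
    then have "(\<integral>\<^sup>+z. norm (g i u z) \<partial>D i) \<le> Gi i"
      using subgradient_moment[OF i, of u] by (subst nn_integral_eq_integral) (auto intro: ennreal_leI)
    then show "(\<integral>\<^sup>+z. (\<lambda>(u, z). ennreal (norm (g i u z))) (u, z) \<partial>distr P (D i) (\<xi> i t)) \<le> Gi i"
      by (simp add: \<xi>_distr[OF i])
  qed
  then have le: "(\<integral>\<^sup>+e. ennreal (?f e) \<partial>P) \<le> ennreal (Gi i)" by simp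
  then show int: "integrable P ?f"
    using f by (intro integrableI_bounded) (auto simp: le_less_trans)
  have "ennreal (\<integral>e. ?f e \<partial>P) = (\<integral>\<^sup>+e. ennreal (?f e) \<partial>P)"
    using int by (intro nn_integral_eq_integral[symmetric]) auto
  then show "(\<integral>e. ?f e \<partial>P) \<le> Gi i"
    using le \<open>Gi i \<ge> 0\<close> by (metis ennreal_le_iff)
qed

lemma error_integrable: "i \<in> {1..N} \<Longrightarrow> integrable P (error i t)"
  using norm_subgradient_moment(1) unfolding error_def[abs_def] by (intro integrable_mult_right) auto

lemma error_moment:
  assumes i: "i \<in> {1..N}"
  shows "(\<integral>e. error i t e \<partial>P) \<le> \<alpha> i t / \<sigma>_low * Gi i"
  unfolding error_def
  using norm_subgradient_moment(2)[OF i, of t] stepsize_pos[OF i, of t] \<sigma>_low_pos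
  by (simp add: divide_right_mono mult_left_mono)

text \<open>Induction on time: each block of the next iterate is within \<open>error i t\<close> of
  a block of \<open>x i t\<close> or of \<open>y i t\<close>, and there are \<open>B\<close>
  blocks.\<close>

lemma x_integrable: "i \<in> {1..N} \<Longrightarrow> integrable P (x i t)"
proof (induction t arbitrary: i)
  case 0
  then obtain K where "\<And>e. e \<in> space P \<Longrightarrow> norm (x i 0 e) \<le> K" using init_bounded by blast
  then show ?case using x_measurable[OF 0] by (intro integrable_const_bound[of _ K]) auto
next
  case (Suc t)
  note i = \<open>i \<in> {1..N}\<close>
  have y: "integrable P (y i t)"
  proof (subst Bochner_Integration.integrable_cong[OF refl y_def[OF i]])
    show "integrable P (\<lambda>e. \<Sum>j=1..N. W i j *\<^sub>R x j t e)"
      using Suc.IH by (intro Bochner_Integration.integrable_sum Bochner_Integration.integrable_scaleR_right) auto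
  qed
  have bound: "norm (x i (Suc t) e) \<le> real B * (norm (x i t e) + norm (y i t e) + error i t e)"
    if e: "e \<in> space P" for e
  proof -
    have "norm (x i (Suc t) e) = norm (\<Sum>l=1..B. block blk l (x i (Suc t) e))"
      unfolding sum_block[OF blk] ..
    also have "\<dots> \<le> (\<Sum>l=1..B. norm (x i t e) + norm (y i t e) + error i t e)"
    proof (rule sum_norm_le)
      fix l assume l: "l \<in> {1..B}"
      have "norm (mixed l t e i) \<le> norm (x i t e) + norm (y i t e)"
        using norm_block_le[of blk l "x i t e"] norm_block_le[of blk l "y i t e"]
        by (auto simp: mixed_def block_y[OF i e, symmetric] intro: add_increasing add_increasing2)
      moreover have "norm (block blk l (x i (Suc t) e))
          \<le> norm (mixed l t e i) + norm (block blk l (x i (Suc t) e) - mixed l t e i)"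
        by (rule norm_triangle_sub)
      ultimately show "norm (block blk l (x i (Suc t) e)) \<le> norm (x i t e) + norm (y i t e) + error i t e"
        using block_x_Suc_near_mixed[OF i e l, of t] by linarith
    qed
    also have "\<dots> = real B * (norm (x i t e) + norm (y i t e) + error i t e)" by simp
    finally show ?thesis .
  qed
  show ?case
  proof (rule Bochner_Integration.integrable_bound)
    show "integrable P (\<lambda>e. real B * (norm (x i t e) + norm (y i t e) + error i t e))"
      using Suc.IH[OF i] y error_integrable[OF i] by auto
    show "AE e in P. norm (x i (Suc t) e) \<le> norm (real B * (norm (x i t e) + norm (y i t e) + error i t e))"
      using bound by (intro AE_I2) (force intro: order_trans)
  qed (rule x_measurable[OF i])
qed

lemma spread_integrable: "integrable P (spread l t k)"
proof (rule Bochner_Integration.integrable_bound)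
  show "integrable P (\<lambda>e. 2 * (\<Sum>i=1..N. norm (x i t e)))"
    using x_integrable by (intro integrable_mult_right integrable_sum) auto
  have "norm (spread l t k e) \<le> norm (2 * (\<Sum>i=1..N. norm (x i t e)))" for e
    using spread_nonneg[of l t k e] spread_le_0[of l t k e] spread_0_le[of l t e] by simp
  then show "AE e in P. norm (spread l t k e) \<le> norm (2 * (\<Sum>i=1..N. norm (x i t e)))"
    by simp
qed (rule spread_measurable)

text \<open>Full activation is a current event and the spreads belong to the past, so the
  expectations of their products factor.\<close>

lemma expected_spread_Suc_le:
  assumes l: "l \<in> {1..B}" and q: "q \<le> prob (all_activated l t)"
  shows "(\<integral>e. spread l (Suc t) k e \<partial>P) \<le> q * (\<integral>e. spread l t (Suc k) e \<partial>P)
    + (1 - q) * (\<integral>e. spread l t 0 e \<partial>P) + 2 * (\<Sum>i=1..N. \<alpha> i t / \<sigma>_low * Gi i)"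
proof -
  let ?A = "all_activated l t"
  let ?I = "\<lambda>k. \<integral>e. spread l t k e \<partial>P"
  have int: "integrable P (\<lambda>e. indicator ?A e * spread l t k e)" for k
    using integrable_mult_indicator[OF all_activated_event spread_integrable] by simp
  have mul: "(\<integral>e. indicator ?A e * spread l t k e \<partial>P) = prob ?A * ?I k" for k
    by (rule integral_indicator_mult_indep[OF current_indep_past space_current space_past
          all_activated_current spread_measurable_past spread_integrable])
  have "(\<integral>e. spread l (Suc t) k e \<partial>P) \<le> (\<integral>e. indicator ?A e * spread l t (Suc k) e
      + (spread l t 0 e - indicator ?A e * spread l t 0 e) + 2 * (\<Sum>i=1..N. error i t e) \<partial>P)"
  proof (rule integral_mono)
    show "integrable P (\<lambda>e. indicator ?A e * spread l t (Suc k) e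
      + (spread l t 0 e - indicator ?A e * spread l t 0 e) + 2 * (\<Sum>i=1..N. error i t e))"
      using int spread_integrable error_integrable
      by (intro Bochner_Integration.integrable_add Bochner_Integration.integrable_diff
          integrable_mult_right integrable_sum) auto
    show "spread l (Suc t) k e \<le> indicator ?A e * spread l t (Suc k) e
      + (spread l t 0 e - indicator ?A e * spread l t 0 e) + 2 * (\<Sum>i=1..N. error i t e)"
      if "e \<in> space P" for e
      using spread_Suc_le[OF that l, of t k] by (simp add: left_diff_distrib)
  qed (rule spread_integrable)
  also have "\<dots> = prob ?A * ?I (Suc k) + (?I 0 - prob ?A * ?I 0)
      + 2 * (\<Sum>i=1..N. \<integral>e. error i t e \<partial>P)"
  proof -
    have sum: "integrable P (\<lambda>e. \<Sum>i=1..N. error i t e)"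
      using error_integrable by (intro Bochner_Integration.integrable_sum) auto
    have "(\<integral>e. (\<Sum>i=1..N. error i t e) \<partial>P) = (\<Sum>i=1..N. \<integral>e. error i t e \<partial>P)"
      using error_integrable by (intro Bochner_Integration.integral_sum) auto
    with sum show ?thesis using int spread_integrable by (simp add: mul del: One_nat_def)
  qed
  also have "\<dots> \<le> q * ?I (Suc k) + (1 - q) * ?I 0 + 2 * (\<Sum>i=1..N. \<integral>e. error i t e \<partial>P)"
  proof -
    \<comment> \<open>Replacing the exact probability by its lower bound \<open>q\<close> moves
      weight from the smaller spread to the larger one.\<close>
    have "?I (Suc k) \<le> ?I 0"
      by (intro integral_mono spread_integrable spread_le_0)
    then have "(prob ?A - q) * ?I (Suc k) \<le> (prob ?A - q) * ?I 0"
      using q by (intro mult_left_mono) auto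
    then show ?thesis by (simp add: algebra_simps)
  qed
  also have "\<dots> \<le> q * ?I (Suc k) + (1 - q) * ?I 0 + 2 * (\<Sum>i=1..N. \<alpha> i t / \<sigma>_low * Gi i)"
    by (intro add_left_mono mult_left_mono sum_mono error_moment) auto
  finally show ?thesis .
qed

lemma deviation_integrable:
  "i \<in> {1..N} \<Longrightarrow> integrable P (\<lambda>e. norm (x i t e - (1 / real N) *\<^sub>R (\<Sum>j=1..N. x j t e)))"
  using x_integrable
  by (intro integrable_norm Bochner_Integration.integrable_diff integrable_scaleR_right integrable_sum) auto

lemma expected_deviation_le:
  "\<exists>K \<rho>. 0 < K \<and> 0 < \<rho> \<and> \<rho> < 1 \<and> (\<forall>i\<in>{1..N}. \<forall>t.
     (\<integral>e. norm (x i t e - (1 / real N) *\<^sub>R (\<Sum>j=1..N. x j t e)) \<partial>P)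
       \<le> K * real B * (\<rho> ^ t * (\<Sum>j=1..N. \<integral>e. norm (x j 0 e) \<partial>P)
           + (\<Sum>s<t. \<rho> ^ (t - s - 1) * (\<Sum>j=1..N. \<alpha> j s / \<sigma>_low * Gi j))))"
proof -
  obtain q where q: "0 < q" "q < 1" "\<And>l t. l \<in> {1..B} \<Longrightarrow> q \<le> prob (all_activated l t)"
    using prob_all_activated_ge by auto
  obtain L \<delta> where L: "L \<ge> 1" and \<delta>: "0 < \<delta>"
    and contr: "\<And>u :: nat \<Rightarrow> real ^ 'n. disagreement N ((mix ^^ L) u) \<le> (1 - \<delta>) * disagreement N u"
    using disagreement_mix_power_contracts by blast
  obtain \<rho> where \<rho>: "0 < \<rho>" "\<rho> < 1"
    and rate: "(1 - q) * (\<Sum>k<L. (q / \<rho>) ^ k) + q * (q / \<rho>) ^ (L - 1) * (1 - \<delta>) \<le> \<rho>"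
    using shift_recursion_rate[OF q(1,2) \<delta> L] by blast
  define w where "w = (\<lambda>k. (q / \<rho>) ^ k)"
  \<comment> \<open>The factor 2 accounts for bounding a disagreement by twice a sum of norms, for
    the initial values as well as for the errors.\<close>
  define K where "K = 2 * (\<Sum>k<L. w k)"
  define I where "I l t k = (\<integral>e. spread l t k e \<partial>P)" for l t k
  define V where "V l t = (\<Sum>k<L. w k * I l t k)" for l t
  define \<epsilon> where "\<epsilon> s = (\<Sum>j=1..N. \<alpha> j s / \<sigma>_low * Gi j)" for s
  define C0 where "C0 = (\<Sum>j=1..N. \<integral>e. norm (x j 0 e) \<partial>P)"
  have w: "w k \<ge> 0" for k using q \<rho> by (simp add: w_def)
  have I_nonneg: "I l t k \<ge> 0" for l t k
    unfolding I_def by (simp add: spread_nonneg)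
  have "w 0 \<le> (\<Sum>k<L. w k)" using L w by (intro member_le_sum) auto
  then have K: "K > 0" by (simp add: K_def w_def)
  have V_step: "V l (Suc t) \<le> \<rho> * V l t + K * \<epsilon> t" if l: "l \<in> {1..B}" for l t
  proof -
    \<comment> \<open>Contraction after \<open>L\<close> virtual steps closes the recursion, which
      would otherwise refer to ever larger \<open>k\<close>.\<close>
    have "I l t L \<le> (\<integral>e. (1 - \<delta>) * spread l t 0 e \<partial>P)"
      unfolding I_def
    proof (rule integral_mono)
      show "spread l t L e \<le> (1 - \<delta>) * spread l t 0 e" for e
        unfolding spread_def using contr by simp
    qed (intro spread_integrable integrable_mult_right)+
    then have "I l t L \<le> (1 - \<delta>) * I l t 0" by (simp add: I_def)
    moreover have "I l (Suc t) k \<le> q * I l t (Suc k) + (1 - q) * I l t 0 + 2 * \<epsilon> t" for k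
      unfolding I_def \<epsilon>_def by (rule expected_spread_Suc_le[OF l q(3)[OF l]])
    ultimately have "(\<Sum>k<L. (q / \<rho>) ^ k * I l (Suc t) k)
        \<le> \<rho> * (\<Sum>k<L. (q / \<rho>) ^ k * I l t k) + (\<Sum>k<L. (q / \<rho>) ^ k) * (2 * \<epsilon> t)"
      by (intro shift_recursion_step[OF q(1) \<rho>(1) rate L]) (auto simp: I_nonneg)
    then show ?thesis by (simp add: V_def K_def w_def mult.assoc mult.left_commute)
  qed
  have V_0: "V l 0 \<le> K * C0" for l
  proof -
    have "I l 0 k \<le> 2 * C0" for k
    proof -
      have "I l 0 k \<le> (\<integral>e. 2 * (\<Sum>i=1..N. norm (x i 0 e)) \<partial>P)"
        unfolding I_def using x_integrable order_trans[OF spread_le_0 spread_0_le]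
        by (intro integral_mono spread_integrable integrable_mult_right integrable_sum) auto
      also have "\<dots> = 2 * C0" using x_integrable by (simp add: C0_def)
      finally show ?thesis .
    qed
    then have "V l 0 \<le> (\<Sum>k<L. w k * (2 * C0))"
      unfolding V_def using w by (intro sum_mono mult_left_mono) auto
    then show ?thesis by (simp add: K_def sum_distrib_right mult.assoc mult.left_commute sum_distrib_left)
  qed
  have V_le: "V l t \<le> K * (\<rho> ^ t * C0 + (\<Sum>s<t. \<rho> ^ (t - s - 1) * \<epsilon> s))" if l: "l \<in> {1..B}" for l t
  proof -
    have "V l t \<le> \<rho> ^ t * V l 0 + (\<Sum>s<t. \<rho> ^ (t - s - 1) * (K * \<epsilon> s))"
      using \<rho> V_step[OF l] by (intro linear_recursion_bound) auto
    also have "\<dots> \<le> \<rho> ^ t * (K * C0) + (\<Sum>s<t. \<rho> ^ (t - s - 1) * (K * \<epsilon> s))"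
      using V_0 \<rho> by (intro add_right_mono mult_left_mono) auto
    also have "\<dots> = K * (\<rho> ^ t * C0 + (\<Sum>s<t. \<rho> ^ (t - s - 1) * \<epsilon> s))"
      by (simp add: distrib_left sum_distrib_left mult.left_commute)
    finally show ?thesis .
  qed
  have "(\<integral>e. norm (x i t e - (1 / real N) *\<^sub>R (\<Sum>j=1..N. x j t e)) \<partial>P)
      \<le> K * real B * (\<rho> ^ t * C0 + (\<Sum>s<t. \<rho> ^ (t - s - 1) * \<epsilon> s))" if i: "i \<in> {1..N}" for i t
  proof -
    have "(\<integral>e. norm (x i t e - (1 / real N) *\<^sub>R (\<Sum>j=1..N. x j t e)) \<partial>P)
        \<le> (\<integral>e. (\<Sum>l=1..B. spread l t 0 e) \<partial>P)"
      by (intro integral_mono deviation_integrable[OF i] Bochner_Integration.integrable_sum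
          spread_integrable deviation_le_spread[OF i])
    also have "\<dots> = (\<Sum>l=1..B. I l t 0)"
      unfolding I_def by (intro Bochner_Integration.integral_sum spread_integrable)
    also have "\<dots> \<le> (\<Sum>l=1..B. K * (\<rho> ^ t * C0 + (\<Sum>s<t. \<rho> ^ (t - s - 1) * \<epsilon> s)))"
    proof (rule sum_mono)
      fix l assume l: "l \<in> {1..B}"
      \<comment> \<open>Since \<open>w 0 = 1\<close>, the Lyapunov function dominates the expected
        disagreement of the actual iterates.\<close>
      have "w 0 * I l t 0 \<le> V l t"
        unfolding V_def using L w I_nonneg
        by (intro member_le_sum[of 0 "{..<L}" "\<lambda>k. w k * I l t k"]) auto
      then have "I l t 0 \<le> V l t" by (simp add: w_def)
      then show "I l t 0 \<le> K * (\<rho> ^ t * C0 + (\<Sum>s<t. \<rho> ^ (t - s - 1) * \<epsilon> s))"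
        using V_le[OF l, of t] by linarith
    qed
    finally show ?thesis by (simp add: mult_ac)
  qed
  then show ?thesis using K \<rho> unfolding C0_def \<epsilon>_def by blast
qed

end

end

text \<open>The bound of \<open>expected_deviation_le\<close> has exponents \<open>t\<close> and
  \<open>t - s - 1\<close>. As 0 < \<rho> < 1 and all terms are nonnegative, lowering these
  exponents by one, except in the last summand, gives the required form with \<open>K\<close> and
  \<rho> as the constants.\<close>

theorem lemma7:
  fixes P :: "'e measure"
    and N B :: nat
    and E :: "(nat \<times> nat) set"
    and W :: "nat \<Rightarrow> nat \<Rightarrow> real"
    and blk :: "'n::finite \<Rightarrow> nat"
    and Xs :: "nat \<Rightarrow> (real ^ 'n) set"
    and D :: "nat \<Rightarrow> 'z measure"
    and h :: "nat \<Rightarrow> real ^ 'n \<Rightarrow> 'z \<Rightarrow> real"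
    and g :: "nat \<Rightarrow> real ^ 'n \<Rightarrow> 'z \<Rightarrow> real ^ 'n"
    and \<omega> :: "nat \<Rightarrow> real ^ 'n \<Rightarrow> real"
    and d\<omega> :: "nat \<Rightarrow> real ^ 'n \<Rightarrow> real ^ 'n"
    and \<sigma> p_on Gi Gi_bar Ci :: "nat \<Rightarrow> real"
    and p \<alpha> :: "nat \<Rightarrow> nat \<Rightarrow> real"
    and s ell :: "nat \<Rightarrow> nat \<Rightarrow> 'e \<Rightarrow> nat"
    and \<xi> :: "nat \<Rightarrow> nat \<Rightarrow> 'e \<Rightarrow> 'z"
    and x y :: "nat \<Rightarrow> nat \<Rightarrow> 'e \<Rightarrow> real ^ 'n"
    and xbar :: "nat \<Rightarrow> 'e \<Rightarrow> real ^ 'n"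
    and \<sigma>_min G C :: real
    and a_M :: "nat \<Rightarrow> real"
  assumes dbpm: "distributed_block_proximal P N E W B blk Xs D h g \<omega> d\<omega> \<sigma> p_on p s ell \<xi> \<alpha> x y"
    and Gi_nonneg: "\<And>i. i \<in> {1..N} \<Longrightarrow> Gi i \<ge> 0"
    and Gi_bar_nonneg: "\<And>i. i \<in> {1..N} \<Longrightarrow> Gi_bar i \<ge> 0"
    and Ci_nonneg: "\<And>i. i \<in> {1..N} \<Longrightarrow> Ci i \<ge> 0"
    and first_moment: "\<And>i u. i \<in> {1..N} \<Longrightarrow> u \<in> block_product blk B Xs \<Longrightarrow>
          integrable (D i) (\<lambda>z. norm (g i u z)) \<and> (\<integral>z. norm (g i u z) \<partial>D i) \<le> Gi i"
    and second_moment: "\<And>i u. i \<in> {1..N} \<Longrightarrow> u \<in> block_product blk B Xs \<Longrightarrow>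
          integrable (D i) (\<lambda>z. (norm (g i u z))\<^sup>2) \<and> (\<integral>z. (norm (g i u z))\<^sup>2 \<partial>D i) \<le> Gi_bar i"
    and init_moment: "\<And>i. i \<in> {1..N} \<Longrightarrow> (\<integral>e. norm (x i 0 e) \<partial>P) \<le> Ci i"
    and G: "G = (\<Sum>i=1..N. Gi i)"
    and C: "C = (\<Sum>i=1..N. Ci i)"
    and \<sigma>_min: "\<sigma>_min = Min (\<sigma> ` {1..B})"
    and a_M: "\<And>t. a_M t = Max ((\<lambda>i. \<alpha> i t) ` {1..N})"
    and xbar: "\<And>t e. xbar t e = (1 / real N) *\<^sub>R (\<Sum>i=1..N. x i t e)"
  shows "\<exists>M \<mu>\<^sub>M :: real. M > 0 \<and> 0 < \<mu>\<^sub>M \<and> \<mu>\<^sub>M < 1 \<and>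
    (\<forall>i\<in>{1..N}. \<forall>t\<ge>1.
       integrable P (\<lambda>e. norm (x i t e - xbar t e)) \<and>
       (\<integral>e. norm (x i t e - xbar t e) \<partial>P)
         \<le> M * real B * (\<mu>\<^sub>M ^ (t - 1) * C
             + G / \<sigma>_min * (\<Sum>s\<in>{..<t - 1}. \<mu>\<^sub>M ^ (t - s - 2) * a_M s)
             + G / \<sigma>_min * a_M (t - 1)))"
proof -
  interpret distributed_block_proximal P N E W B blk Xs D h g \<omega> d\<omega> \<sigma> p_on p s ell \<xi> \<alpha> x y
    by (rule dbpm)
  have low: "\<sigma>_low = \<sigma>_min" by (simp add: \<sigma>_low_def \<sigma>_min)
  have pos: "\<sigma>_min > 0" using \<sigma>_low_pos low by simp
  obtain K \<rho> where K: "0 < K" and \<rho>: "0 < \<rho>" "\<rho> < 1"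
    and bound: "\<And>i t. i \<in> {1..N} \<Longrightarrow>
      (\<integral>e. norm (x i t e - (1 / real N) *\<^sub>R (\<Sum>j=1..N. x j t e)) \<partial>P)
       \<le> K * real B * (\<rho> ^ t * (\<Sum>j=1..N. \<integral>e. norm (x j 0 e) \<partial>P)
           + (\<Sum>s<t. \<rho> ^ (t - s - 1) * (\<Sum>j=1..N. \<alpha> j s / \<sigma>_min * Gi j)))"
    using expected_deviation_le[of Gi] first_moment unfolding low by blast
  have C0: "(\<Sum>j=1..N. \<integral>e. norm (x j 0 e) \<partial>P) \<le> C"
    unfolding C using init_moment by (intro sum_mono) auto
  have "C \<ge> 0" unfolding C using Ci_nonneg by (intro sum_nonneg) auto
  have "G \<ge> 0" unfolding G using Gi_nonneg by (intro sum_nonneg) auto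
  have \<alpha>_le: "\<alpha> j t \<le> a_M t" if "j \<in> {1..N}" for j t
    unfolding a_M using that by (intro Max_ge) auto
  have "1 \<in> {1..N}" using N_pos by simp
  then have a_nonneg: "a_M t \<ge> 0" for t
    using \<alpha>_le[of 1 t] stepsize_pos[of 1 t] by linarith
  have step: "(\<Sum>j=1..N. \<alpha> j t / \<sigma>_min * Gi j) \<le> G / \<sigma>_min * a_M t" for t
  proof -
    have "(\<Sum>j=1..N. \<alpha> j t / \<sigma>_min * Gi j) \<le> (\<Sum>j=1..N. a_M t / \<sigma>_min * Gi j)"
      using \<alpha>_le Gi_nonneg pos by (intro sum_mono mult_right_mono divide_right_mono) auto
    also have "\<dots> = G / \<sigma>_min * a_M t" unfolding G sum_distrib_left[symmetric] by simp
    finally show ?thesis .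
  qed
  have "(\<integral>e. norm (x i t e - xbar t e) \<partial>P)
      \<le> K * real B * (\<rho> ^ (t - 1) * C
           + G / \<sigma>_min * (\<Sum>s\<in>{..<t - 1}. \<rho> ^ (t - s - 2) * a_M s)
           + G / \<sigma>_min * a_M (t - 1))" if i: "i \<in> {1..N}" and t: "t \<ge> 1" for i t
  proof -
    obtain r where r: "t = Suc r" using t by (cases t) auto
    have "\<rho> ^ t * (\<Sum>j=1..N. \<integral>e. norm (x j 0 e) \<partial>P) \<le> \<rho> ^ t * C"
      using C0 \<rho> by (intro mult_left_mono) auto
    also have "\<dots> \<le> \<rho> ^ r * C"
      using \<rho> \<open>C \<ge> 0\<close> unfolding r by (intro mult_right_mono power_decreasing) auto
    finally have 1: "\<rho> ^ t * (\<Sum>j=1..N. \<integral>e. norm (x j 0 e) \<partial>P) \<le> \<rho> ^ r * C" .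
    have "(\<Sum>s<t. \<rho> ^ (t - s - 1) * (\<Sum>j=1..N. \<alpha> j s / \<sigma>_min * Gi j))
        \<le> (\<Sum>s<t. \<rho> ^ (t - s - 1) * (G / \<sigma>_min * a_M s))"
      using step \<rho> by (intro sum_mono mult_left_mono) auto
    \<comment> \<open>The summand \<open>s = t - 1\<close> has exponent 0 and becomes the separate
      last term.\<close>
    also have "\<dots> = (\<Sum>s<r. \<rho> ^ (r - s) * (G / \<sigma>_min * a_M s)) + G / \<sigma>_min * a_M r"
      by (simp add: r)
    also have "(\<Sum>s<r. \<rho> ^ (r - s) * (G / \<sigma>_min * a_M s))
        \<le> (\<Sum>s<r. \<rho> ^ (t - s - 2) * (G / \<sigma>_min * a_M s))"
      using \<rho> \<open>G \<ge> 0\<close> pos a_nonneg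
      by (intro sum_mono mult_right_mono power_decreasing) (auto simp: r)
    also have "\<dots> = G / \<sigma>_min * (\<Sum>s<r. \<rho> ^ (t - s - 2) * a_M s)"
      by (simp add: sum_distrib_left mult.left_commute)
    finally have 2: "(\<Sum>s<t. \<rho> ^ (t - s - 1) * (\<Sum>j=1..N. \<alpha> j s / \<sigma>_min * Gi j))
        \<le> G / \<sigma>_min * (\<Sum>s<r. \<rho> ^ (t - s - 2) * a_M s) + G / \<sigma>_min * a_M r"
      by simp
    have "(\<integral>e. norm (x i t e - xbar t e) \<partial>P)
       \<le> K * real B * (\<rho> ^ t * (\<Sum>j=1..N. \<integral>e. norm (x j 0 e) \<partial>P)
           + (\<Sum>s<t. \<rho> ^ (t - s - 1) * (\<Sum>j=1..N. \<alpha> j s / \<sigma>_min * Gi j)))"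
      unfolding xbar by (rule bound[OF i])
    also have "\<dots> \<le> K * real B * (\<rho> ^ r * C
        + (G / \<sigma>_min * (\<Sum>s<r. \<rho> ^ (t - s - 2) * a_M s) + G / \<sigma>_min * a_M r))"
      using K by (intro mult_left_mono add_mono 1 2) auto
    finally show ?thesis by (simp add: r add.assoc)
  qed
  moreover have "integrable P (\<lambda>e. norm (x i t e - xbar t e))" if "i \<in> {1..N}" for i t
    unfolding xbar using deviation_integrable[of Gi, OF first_moment that] by blast
  ultimately show ?thesis using K \<rho> by blast
qed

end
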